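(* Let $X$ be a smooth non-Euclidean $d$-dimensional real normed space with only finitely many linear isometries, and let $(G,p)$ be a framework in $X$, where $G=(V,E)$ has at least two vertices and $p$ is a completely strongly regular placement of $V$. If $(G,p)$ is globally rigid, then $(G,p)$ is redundantly rigid.
   Context: A normed space is non-Euclidean if its norm does not satisfy the parallelogram law. A support functional of $x\in X$ is $f\in X^*$ with $f(x)=\|x\|^2$ and $\|f\|^*=\|x\|$; a non-zero $x$ is smooth if it has a unique support functional $\varphi_x$, and $X$ is smooth if every non-zero point is smooth. For a graph $G=(V,E)$ and $p\in X^V$, $(G,p)$ is a framework; $f_G:X^V\to\mathbb{R}^E$, $p\mapsto(\tfrac12\|p_v-p_w\|^2)_{vw\in E}$. $(G,p)$ and $(G,q)$ are equivalent if $f_G(p)=f_G(q)$, and congruent if $q_v=g(p_v)$ for all $v$ for some isometry $g$ of $X$; $(G,p)$ is globally rigid if every equivalent framework is congruent to it. $(G,p)$ is well-positioned if $p_v-p_w$ is non-zero and smooth for all $vw\in E$; its rigidity operator is $df_G(p)(x)=(\varphi_{p_v-p_w}(x_v-x_w))_{vw\in E}$ for $x\in X^V$, whose kernel elements are infinitesimal flexes. A flex $u$ is trivial if there are a linear $T:X\to X$ and $z\in X$ with $u_v=T(p_v)+z$ for all $v$ and $f(T(x))=0$ for all $x\in X$ and all support functionals $f$ of $x$; $(G,p)$ is infinitesimally rigid if all flexes are trivial, and redundantly rigid if $(G-e,p)$ is infinitesimally rigid for every $e\in E$. A well-positioned $(G,p)$ is strongly regular if every framework equivalent to $(G,p)$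 is well-positioned with rigidity operator of rank equal to the maximum rank of $df_G(q)$ over all well-positioned placements $q$ of $G$. A placement $p$ of a set $V$ is completely strongly regular if for every graph $H$ with vertex set $V$, $(H,p)$ is well-positioned and strongly regular. *)

theory Defs
  imports "HOL-Analysis.Analysis"
begin

section \<open>Normed spaces\<close>

definition non_Euclidean :: "'a::real_normed_vector itself \<Rightarrow> bool" where
  "non_Euclidean _ \<longleftrightarrow>
     \<not> (\<forall>x y::'a. (norm (x + y))\<^sup>2 + (norm (x - y))\<^sup>2 = 2 * (norm x)\<^sup>2 + 2 * (norm y)\<^sup>2)"

definition has_dimension :: "'a::real_vector itself \<Rightarrow> nat \<Rightarrow> bool" where
  "has_dimension _ d \<longleftrightarrow>
     (\<exists>B::'a set. finite B \<and> independent B \<and> span B = UNIV \<and> card B = d)"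

definition support_functional :: "'a::real_normed_vector \<Rightarrow> ('a \<Rightarrow>\<^sub>L real) \<Rightarrow> bool" where
  "support_functional x f \<longleftrightarrow> blinfun_apply f x = (norm x)\<^sup>2 \<and> norm f = norm x"

definition smooth_point :: "'a::real_normed_vector \<Rightarrow> bool" where
  "smooth_point x \<longleftrightarrow> x \<noteq> 0 \<and> (\<exists>!f. support_functional x f)"

definition smooth_space :: "'a::real_normed_vector itself \<Rightarrow> bool" where
  "smooth_space _ \<longleftrightarrow> (\<forall>x::'a. x \<noteq> 0 \<longrightarrow> smooth_point x)"

definition the_support_functional :: "'a::real_normed_vector \<Rightarrow> 'a \<Rightarrow>\<^sub>L real" where
  "the_support_functional x = (THE f. support_functional x f)"

definition isometry :: "('a::real_normed_vector \<Rightarrow> 'a) \<Rightarrow> bool" where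
  "isometry g \<longleftrightarrow> bij g \<and> (\<forall>x y. dist (g x) (g y) = dist x y)"

definition linear_isometries :: "('a::real_normed_vector \<Rightarrow> 'a) set" where
  "linear_isometries = {T. linear T \<and> isometry T}"

section \<open>Graphs and frameworks\<close>

text \<open>The vertex set \<open>V\<close> is the universe of a finite type \<open>'v\<close>, so a graph is given by its set
  of edges, which are unordered pairs of distinct vertices, and the space of placements \<open>X\<^sup>V\<close>
  is \<^typ>\<open>'a^'v\<close>. The space of real vectors indexed by the edge set \<open>E\<close> is the subspace
  of \<^typ>\<open>real^('v set)\<close> of vectors vanishing at all indices outside \<open>E\<close>.\<close>

definition simple_graph :: "'v::finite set set \<Rightarrow> bool" where
  "simple_graph E \<longleftrightarrow> (\<forall>e\<in>E. card e = 2)"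

text \<open>An arbitrary fixed orientation of each edge. Neither the measurement map nor the rigidity
  operator of a well-positioned framework depends on it; see \<open>measurement_nth\<close> and
  \<open>rigidity_operator_nth\<close> below.\<close>

definition edge_ends :: "'v set \<Rightarrow> 'v \<times> 'v" where
  "edge_ends e = (SOME vw. e = {fst vw, snd vw})"

definition edge_diff :: "('a::real_normed_vector)^('v::finite) \<Rightarrow> 'v set \<Rightarrow> 'a" where
  "edge_diff p e = p $ fst (edge_ends e) - p $ snd (edge_ends e)"

definition measurement ::
    "'v::finite set set \<Rightarrow> ('a::real_normed_vector)^'v \<Rightarrow> real^('v set)" where
  "measurement E p = (\<chi> e. if e \<in> E then 1/2 * (norm (edge_diff p e))\<^sup>2 else 0)"

definition equivalent_frameworks ::
    "'v::finite set set \<Rightarrow> ('a::real_normed_vector)^'v \<Rightarrow> 'a^'v \<Rightarrow> bool" where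
  "equivalent_frameworks E p q \<longleftrightarrow> measurement E p = measurement E q"

definition congruent_frameworks ::
    "('a::real_normed_vector)^('v::finite) \<Rightarrow> 'a^'v \<Rightarrow> bool" where
  "congruent_frameworks p q \<longleftrightarrow> (\<exists>g. isometry g \<and> (\<forall>v. q $ v = g (p $ v)))"

definition globally_rigid ::
    "'v::finite set set \<Rightarrow> ('a::real_normed_vector)^'v \<Rightarrow> bool" where
  "globally_rigid E p \<longleftrightarrow> (\<forall>q. equivalent_frameworks E p q \<longrightarrow> congruent_frameworks p q)"

definition well_positioned ::
    "'v::finite set set \<Rightarrow> ('a::real_normed_vector)^'v \<Rightarrow> bool" where
  "well_positioned E p \<longleftrightarrow> (\<forall>v w. {v, w} \<in> E \<longrightarrow> smooth_point (p $ v - p $ w))"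

definition rigidity_operator ::
    "'v::finite set set \<Rightarrow> ('a::real_normed_vector)^'v \<Rightarrow> 'a^'v \<Rightarrow> real^('v set)" where
  "rigidity_operator E p x =
     (\<chi> e. if e \<in> E
          then blinfun_apply (the_support_functional (edge_diff p e)) (edge_diff x e) else 0)"

definition infinitesimal_flex ::
    "'v::finite set set \<Rightarrow> ('a::real_normed_vector)^'v \<Rightarrow> 'a^'v \<Rightarrow> bool" where
  "infinitesimal_flex E p u \<longleftrightarrow> rigidity_operator E p u = 0"

definition trivial_flex :: "('a::real_normed_vector)^('v::finite) \<Rightarrow> 'a^'v \<Rightarrow> bool" where
  "trivial_flex p u \<longleftrightarrow>
     (\<exists>(T::'a \<Rightarrow> 'a) z. linear T \<and> (\<forall>v. u $ v = T (p $ v) + z) \<and>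
        (\<forall>x f. support_functional x f \<longrightarrow> blinfun_apply f (T x) = 0))"

definition infinitesimally_rigid ::
    "'v::finite set set \<Rightarrow> ('a::real_normed_vector)^'v \<Rightarrow> bool" where
  "infinitesimally_rigid E p \<longleftrightarrow>
     well_positioned E p \<and> (\<forall>u. infinitesimal_flex E p u \<longrightarrow> trivial_flex p u)"

definition redundantly_rigid ::
    "'v::finite set set \<Rightarrow> ('a::real_normed_vector)^'v \<Rightarrow> bool" where
  "redundantly_rigid E p \<longleftrightarrow> (\<forall>e\<in>E. infinitesimally_rigid (E - {e}) p)"

definition rigidity_rank ::
    "'v::finite set set \<Rightarrow> ('a::real_normed_vector)^'v \<Rightarrow> nat" where
  "rigidity_rank E p = dim (range (rigidity_operator E p))"

definition strongly_regular ::
    "'v::finite set set \<Rightarrow> ('a::real_normed_vector)^'v \<Rightarrow> bool" where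
  "strongly_regular E p \<longleftrightarrow>
     well_positioned E p \<and>
     (\<forall>q. equivalent_frameworks E p q \<longrightarrow>
        well_positioned E q \<and>
        rigidity_rank E q = Max {rigidity_rank E r | r::'a^'v. well_positioned E r})"

definition completely_strongly_regular ::
    "('a::real_normed_vector)^('v::finite) \<Rightarrow> bool" where
  "completely_strongly_regular p \<longleftrightarrow>
     (\<forall>H. simple_graph H \<longrightarrow> well_positioned H p \<and> strongly_regular H p)"

section \<open>Independence of the orientation\<close>

lemma edge_diff_cases:
  "(\<forall>p::('a::real_normed_vector)^('v::finite). edge_diff p {v, w} = p $ v - p $ w) \<or>
   (\<forall>p::'a^'v. edge_diff p {v, w} = p $ w - p $ v)"
proof -
  have "{v, w} = {fst (edge_ends {v, w}), snd (edge_ends {v, w})}"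
    unfolding edge_ends_def by (rule someI[of _ "(v, w)"]) simp
  then have "fst (edge_ends {v, w}) = v \<and> snd (edge_ends {v, w}) = w \<or>
      fst (edge_ends {v, w}) = w \<and> snd (edge_ends {v, w}) = v"
    by (metis doubleton_eq_iff)
  then show ?thesis
    unfolding edge_diff_def by auto
qed

lemma support_functional_minus:
  "support_functional (- x) f \<longleftrightarrow> support_functional x (- f)"
  by (simp add: support_functional_def blinfun.minus_left blinfun.minus_right)

lemma the_support_functional_minus:
  assumes "smooth_point x"
  shows "the_support_functional (- x) = - the_support_functional x"
proof -
  have ex: "\<exists>!f. support_functional x f"
    using assms by (simp add: smooth_point_def)
  then have "support_functional x (the_support_functional x)"
    unfolding the_support_functional_def by (rule theI')
  then have "support_functional (- x) f \<longleftrightarrow> f = - the_support_functional x" for f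
    using ex unfolding support_functional_minus by (metis minus_minus)
  then show ?thesis
    unfolding the_support_functional_def[of "- x"] by (intro the_equality) auto
qed

lemma measurement_nth:
  fixes p :: "('a::real_normed_vector)^('v::finite)"
  assumes "{v, w} \<in> E"
  shows "measurement E p $ {v, w} = 1/2 * (norm (p $ v - p $ w))\<^sup>2"
  using assms edge_diff_cases[where 'a='a, of v w] norm_minus_commute[of "p $ v" "p $ w"]
  unfolding measurement_def by auto

lemma rigidity_operator_nth:
  fixes p :: "('a::real_normed_vector)^('v::finite)"
  assumes "well_positioned E p" and "{v, w} \<in> E"
  shows "rigidity_operator E p x $ {v, w} =
    blinfun_apply (the_support_functional (p $ v - p $ w)) (x $ v - x $ w)"
proof -
  have "smooth_point (p $ v - p $ w)"
    using assms by (auto simp: well_positioned_def)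
  from the_support_functional_minus[OF this]
  have "the_support_functional (p $ w - p $ v) = - the_support_functional (p $ v - p $ w)"
    by simp
  then show ?thesis
    using assms(2) edge_diff_cases[where 'a='a, of v w]
    unfolding rigidity_operator_def
    by (auto simp: blinfun.minus_left blinfun.diff_right)
qed

end

theory Submission imports Defs
begin

text \<open>
  Suppose that \<open>H = G - e\<close> is not infinitesimally rigid at \<open>p\<close>, and pin one vertex. By the theorem of
  Mazur and Ulam every placement equivalent to \<open>p\<close> for \<open>G\<close> is the image of \<open>p\<close> under one of finitely
  many linear isometries, so the fibre of \<open>G\<close> through \<open>p\<close> is finite. Hence \<open>H\<close> is connected, and the constant rank
  theorem shows that \<open>G\<close> has no pinned infinitesimal flex, so that the pinned flexes of \<open>H\<close> are
  one-dimensional along the whole fibre of \<open>H\<close>. That fibre is therefore a compact 1-manifold,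
  and \<open>p\<close> is a boundary point of the part of it on which the edge \<open>e\<close> is at least as long as in \<open>p\<close>;
  all boundary points are images of \<open>p\<close>. A compact connected 1-manifold with a boundary point is an arc
  with two ends, so an isometry \<open>T\<close> maps the component of \<open>p\<close> to itself and, being a continuous map of an
  arc to itself, fixes a placement \<open>z\<close> on it. All points of \<open>z\<close> are then fixed by \<open>T\<close>, so that support functionals
  of their differences vanish on every \<open>w - T w\<close>. Each of at least two unpinned vertices can thus be moved
  independently, which contradicts the one-dimensionality.
\<close>

section \<open>One-dimensional manifolds with boundary\<close>

text \<open>Along the fibre of \<open>H\<close> the length of \<open>e\<close> may have critical
  points, so the part where it is at least its value at \<open>p\<close> need not look like a
  manifold with boundary for an arbitrary cutting level. The level of \<open>p\<close> is safe: a
  point of the fibre of \<open>H\<close> on it lies in the fibre of \<open>G\<close>, and there no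
  nonzero pinned flex of \<open>H\<close> keeps the length of \<open>e\<close> to first order. The
  length is thus a chart at every boundary point, while a linear functional serves as chart
  elsewhere. At the fixed placement \<open>z\<close> nothing else is known, and it is strong
  regularity of \<open>H\<close> that still bounds its pinned flexes by dimension one. Being
  non-Euclidean forces dimension at least two, which makes spheres infinite and so prevents
  \<open>e\<close> from being a bridge.\<close>

definition open_chart_at :: "'a::topological_space set \<Rightarrow> 'a \<Rightarrow> bool" where
  "open_chart_at S x \<longleftrightarrow>
     (\<exists>U a b f g. open U \<and> x \<in> U \<and> homeomorphism (S \<inter> U) {a<..<b::real} f g)"

text \<open>The condition \<open>f x = a\<close> makes \<open>x\<close> itself the end;
  \<open>{a..<b}\<close> alone could also be a chart around a nearby interior point. In both
  definitions the interval is nonempty only once \<open>x \<in> S\<close> is known.\<close>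

definition end_chart_at :: "'a::topological_space set \<Rightarrow> 'a \<Rightarrow> bool" where
  "end_chart_at S x \<longleftrightarrow>
     (\<exists>U a b f g. open U \<and> x \<in> U \<and> homeomorphism (S \<inter> U) {a..<b::real} f g \<and> f x = a)"

section \<open>Charts are local and pass to components\<close>

lemma open_chart_at_local:
  assumes "open_chart_at S x" "x \<in> S" "open W" "x \<in> W" and eq: "S \<inter> W = S' \<inter> W"
  shows "open_chart_at S' x"
proof -
  obtain U a b f g where U: "open U" "x \<in> U" and hom: "homeomorphism (S \<inter> U) {a<..<b::real} f g"
    using assms(1) unfolding open_chart_at_def by blast
  have fx: "f x \<in> {a<..<b}" "g (f x) = x"
    using homeomorphism_image1[OF hom] homeomorphism_apply1[OF hom] assms(2) U(2) by blast+
  \<comment> \<open>The chart is shrunk to an interval around \<open>f x\<close> that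
    \<open>g\<close> sends into \<open>W\<close>, where \<open>S\<close> and \<open>S'\<close>
    agree.\<close>
  have "open ({a<..<b} \<inter> g -` W)"
    by (rule continuous_open_preimage[OF homeomorphism_cont2[OF hom] _ assms(3)]) simp
  then obtain r where r: "0 < r" "ball (f x) r \<subseteq> {a<..<b} \<inter> g -` W"
    using fx assms(4) by (metis IntI open_contains_ball vimage_eq)
  have "openin (top_of_set (S \<inter> U)) (S \<inter> U \<inter> f -` ball (f x) r)"
    by (rule continuous_openin_preimage_gen[OF homeomorphism_cont1[OF hom]]) simp
  then obtain Q where Q: "open Q" "S \<inter> U \<inter> f -` ball (f x) r = S \<inter> U \<inter> Q"
    unfolding openin_open by blast
  have x: "x \<in> U \<inter> W \<inter> Q" using Q(2) U(2) assms(2,4) r(1) by auto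
  have fg: "f (g t) = t" "g t \<in> S \<inter> U" if "t \<in> {a<..<b}" for t
    using that homeomorphism_apply2[OF hom] homeomorphism_image2[OF hom] by blast+
  have "f ` (S' \<inter> (U \<inter> W \<inter> Q)) = ball (f x) r"
  proof
    show "f ` (S' \<inter> (U \<inter> W \<inter> Q)) \<subseteq> ball (f x) r" using eq Q(2) by blast
    show "ball (f x) r \<subseteq> f ` (S' \<inter> (U \<inter> W \<inter> Q))"
    proof
      fix t assume t: "t \<in> ball (f x) r"
      then have "g t \<in> S \<inter> U \<inter> f -` ball (f x) r" "g t \<in> W" "f (g t) = t" using fg r(2) by auto
      then show "t \<in> f ` (S' \<inter> (U \<inter> W \<inter> Q))" using Q(2) eq by (intro image_eqI[of _ _ "g t"]) auto
    qed
  qed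
  then have "homeomorphism (S' \<inter> (U \<inter> W \<inter> Q)) {f x - r<..<f x + r} f g"
    using eq r(2) by (intro homeomorphism_of_subsets[OF hom]) (auto simp: ball_eq_greaterThanLessThan)
  then show ?thesis
    unfolding open_chart_at_def using x U(1) Q(1) assms(3) by (metis open_Int)
qed

text \<open>A chart domain is the image of an interval, hence connected, and so lies in the
  component of each of its points.\<close>

lemma connected_component_Int_chart:
  assumes "homeomorphism (S \<inter> U) (I::real set) f g" "convex I" "x \<in> U" "x \<in> connected_component_set S p"
  shows "connected_component_set S p \<inter> U = S \<inter> U"
proof -
  have "connected (S \<inter> U)"
    using assms(1,2) by (metis convex_connected connected_continuous_image homeomorphism_def)
  moreover have "x \<in> S \<inter> U" using assms(3,4) connected_component_subset by fastforce
  ultimately have "S \<inter> U \<subseteq> connected_component_set S x" by (intro connected_component_maximal) auto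
  also have "connected_component_set S x = connected_component_set S p"
    using assms(4) connected_component_eq by blast
  finally show ?thesis using connected_component_subset by blast
qed

lemma open_chart_at_component:
  assumes "open_chart_at S x" "x \<in> connected_component_set S p"
  shows "open_chart_at (connected_component_set S p) x"
proof -
  obtain U a b f g where U: "open U" "x \<in> U" and hom: "homeomorphism (S \<inter> U) {a<..<b::real} f g"
    using assms(1) unfolding open_chart_at_def by blast
  then show ?thesis
    using connected_component_Int_chart[OF hom convex_real_interval(8) U(2) assms(2)]
    unfolding open_chart_at_def by metis
qed

lemma end_chart_at_component:
  assumes "end_chart_at S x" "x \<in> connected_component_set S p"
  shows "end_chart_at (connected_component_set S p) x"
proof -
  obtain U a b f g where U: "open U" "x \<in> U" and hom: "homeomorphism (S \<inter> U) {a..<b::real} f g"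
    and "f x = a"
    using assms(1) unfolding end_chart_at_def by blast
  then show ?thesis
    using connected_component_Int_chart[OF hom convex_real_interval(7) U(2) assms(2)]
    unfolding end_chart_at_def by metis
qed

text \<open>In a chart, \<open>\<alpha>\<close> becomes an injective continuous real function, so by
  the intermediate value theorem it covers both sides of every interior parameter. At parameter 0
  one side is enough, because an end chart has no values below \<open>f x\<close>. The endpoint is
  left out since \<open>S\<close> may continue beyond it.\<close>

lemma openin_initial_segment:
  fixes \<alpha> :: "real \<Rightarrow> 'a::metric_space"
  assumes charts: "\<And>x. x \<in> S \<Longrightarrow> open_chart_at S x \<or> end_chart_at S x"
    and end0: "end_chart_at S (\<alpha> 0)"
    and cont: "continuous_on {0..s} \<alpha>" and inj: "inj_on \<alpha> {0..s}"
    and sub: "\<alpha> ` {0..s} \<subseteq> S"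
  shows "openin (top_of_set S) (\<alpha> ` {0..<s})"
proof (subst openin_subopen, intro ballI)
  fix x assume "x \<in> \<alpha> ` {0..<s}"
  then obtain t where t: "0 \<le> t" "t < s" and x: "x = \<alpha> t" by auto
  have xS: "x \<in> S" using sub t x by auto
  have "\<exists>U I f g. open U \<and> x \<in> U \<and> homeomorphism (S \<inter> U) I f g \<and>
      (t = 0 \<longrightarrow> (\<forall>y\<in>I. f x \<le> (y::real)))"
  proof (cases "t = 0")
    case True
    obtain U a b f g where "open U" "x \<in> U" "homeomorphism (S \<inter> U) {a..<b::real} f g" "f x = a"
      using end0 True x unfolding end_chart_at_def by auto
    then show ?thesis by (intro exI[of _ U] exI[of _ "{a..<b}"] exI[of _ f] exI[of _ g]) auto
  next
    case False
    then show ?thesis using charts[OF xS] unfolding open_chart_at_def end_chart_at_def by metis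
  qed
  then obtain U I f g where U: "open U" "x \<in> U" and hom: "homeomorphism (S \<inter> U) I f g"
    and I0: "t = 0 \<longrightarrow> (\<forall>y\<in>I. f x \<le> (y::real))" by blast
  have contf: "continuous_on (S \<inter> U) f" and fI: "f ` (S \<inter> U) = I"
    and gf: "\<And>y. y \<in> S \<inter> U \<Longrightarrow> g (f y) = y"
    using hom by (auto simp: homeomorphism_def)
  have "openin (top_of_set {0..s}) ({0..s} \<inter> \<alpha> -` U)"
    using cont U(1) by (simp add: continuous_openin_preimage_gen)
  then obtain \<eta> where \<eta>: "\<eta> > 0" "ball t \<eta> \<inter> {0..s} \<subseteq> {0..s} \<inter> \<alpha> -` U"
    using t x U(2) unfolding openin_contains_ball by (auto dest!: bspec[of _ _ t])
  \<comment> \<open>Both bounds stay within half of \<open>\<eta>\<close> from \<open>t\<close>, so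
    \<open>\<alpha>\<close> remains in the chart; \<open>r1\<close> is clipped at 0, and
    \<open>r2 < s\<close> keeps the covered points in the half-open segment.\<close>
  define r2 where "r2 = min ((t + s)/2) (t + \<eta>/2)"
  define r1 where "r1 = max 0 (t - \<eta>/2)"
  have r: "0 \<le> r1" "r1 \<le> t" "t < r2" "r2 < s" "t \<noteq> 0 \<Longrightarrow> r1 < t"
    using t \<eta> by (auto simp: r1_def r2_def min_def)
  have \<alpha>U: "\<alpha> r \<in> S \<inter> U" if "r \<in> {r1..r2}" for r
  proof -
    have "r \<in> ball t \<eta> \<inter> {0..s}"
      using that r \<eta>(1) by (auto simp: r1_def r2_def dist_real_def)
    then show ?thesis using \<eta> sub by auto
  qed
  define h where "h = f \<circ> \<alpha>"
  have sub2: "{r1..r2} \<subseteq> {0..s}" using r by auto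
  have conth: "continuous_on {r1..r2} h"
    unfolding h_def using \<alpha>U
    by (intro continuous_on_compose continuous_on_subset[OF cont sub2] continuous_on_subset[OF contf]) auto
  have injh: "inj_on h {r1..r2}"
    unfolding h_def
  proof (rule comp_inj_on)
    show "inj_on \<alpha> {r1..r2}" by (rule inj_on_subset[OF inj sub2])
    show "inj_on f (\<alpha> ` {r1..r2})" using gf \<alpha>U by (intro inj_on_inverseI[of _ g]) auto
  qed
  have hI: "h r \<in> I" if "r \<in> {r1..r2}" for r
    using \<alpha>U[OF that] fI by (auto simp: h_def)
  have ivt: "\<exists>r\<in>{r1..r2}. h r = y" if "c \<in> {r1..r2}" "d \<in> {r1..r2}" "h c \<le> y" "y \<le> h d" for c d y
  proof -
    have "connected (h ` {r1..r2})" by (intro connected_continuous_image conth) auto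
    then have "y \<in> h ` {r1..r2}"
      using that unfolding connected_iff_interval by blast
    then show ?thesis by auto
  qed
  have "\<exists>J. open J \<and> f x \<in> J \<and> (\<forall>y\<in>J \<inter> I. \<exists>r\<in>{r1..r2}. h r = y)"
  proof (cases "t = 0")
    case True
    have "h r2 \<noteq> h t" using inj_onD[OF injh, of r2 t] r by auto
    moreover have "h t \<le> h r2" using I0 True hI[of r2] r by (auto simp: h_def x)
    ultimately have "h t < h r2" by simp
    then show ?thesis
      using I0 True r ivt[of t r2] by (intro exI[of _ "{..<h r2}"]) (auto simp: h_def x)
  next
    case False
    then have "r1 < t" "t < r2" using r by auto
    from continuous_inj_imp_mono[OF this conth injh]
    consider "h r1 < h t" "h t < h r2" | "h r2 < h t" "h t < h r1" by blast
    then show ?thesis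
    proof cases
      case 1
      then show ?thesis using ivt[of r1 r2] r
        by (intro exI[of _ "{h r1<..<h r2}"]) (auto simp: h_def x)
    next
      case 2
      then show ?thesis using ivt[of r2 r1] r
        by (intro exI[of _ "{h r2<..<h r1}"]) (auto simp: h_def x)
    qed
  qed
  then obtain J where J: "open J" "f x \<in> J" and Jsub: "\<And>y. y \<in> J \<Longrightarrow> y \<in> I \<Longrightarrow> \<exists>r\<in>{r1..r2}. h r = y"
    by blast
  have "openin (top_of_set (S \<inter> U)) (S \<inter> U \<inter> f -` J)"
    using contf J(1) by (simp add: continuous_openin_preimage_gen)
  then have "openin (top_of_set S) (S \<inter> U \<inter> f -` J)"
    using U(1) openin_open_Int openin_trans by blast
  moreover have "S \<inter> U \<inter> f -` J \<subseteq> \<alpha> ` {0..<s}"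
  proof
    fix y assume y: "y \<in> S \<inter> U \<inter> f -` J"
    then obtain r where "r \<in> {r1..r2}" "h r = f y" using Jsub[of "f y"] fI by auto
    then have "y = \<alpha> r" using gf[of y] gf[OF \<alpha>U] y by (metis IntE comp_apply h_def IntI)
    then show "y \<in> \<alpha> ` {0..<s}" using \<open>r \<in> {r1..r2}\<close> r by auto
  qed
  ultimately show "\<exists>T. openin (top_of_set S) T \<and> x \<in> T \<and> T \<subseteq> \<alpha> ` {0..<s}"
    using xS U J by blast
qed

text \<open>Chart domains are path connected, so path components are relatively open, and a
  connected set cannot split into several of them.\<close>

lemma path_connected_charts:
  fixes S :: "'a::real_normed_vector set"
  assumes charts: "\<And>x. x \<in> S \<Longrightarrow> open_chart_at S x \<or> end_chart_at S x"
    and "connected S"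
  shows "path_connected S"
  unfolding path_connected_component
proof (intro ballI)
  have loc: "\<exists>T. openin (top_of_set S) T \<and> x \<in> T \<and> (\<forall>y\<in>T. path_component S x y)" if xS: "x \<in> S" for x
  proof -
    obtain U I f g where U: "open U" "x \<in> U" and hom: "homeomorphism (S \<inter> U) I f g"
      and I: "convex (I::real set)"
      using charts[OF xS] unfolding open_chart_at_def end_chart_at_def
      by (metis convex_real_interval(7) convex_real_interval(8))
    have "path_connected I" using I by (rule convex_imp_path_connected)
    then have "path_connected (S \<inter> U)"
      using hom by (metis homeomorphism_def path_connected_continuous_image)
    then have "\<forall>y\<in>S \<inter> U. path_component S x y"
      using xS U by (meson IntI inf_le1 path_component_of_subset path_connected_component)
    then show ?thesis using U xS openin_open_Int[of U S] by blast
  qed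
  show "path_component S x y" if "x \<in> S" "y \<in> S" for x y
    by (rule connected_equivalence_relation[OF \<open>connected S\<close> that, where R = "path_component S"])
      (auto intro: path_component_sym path_component_trans loc)
qed

lemma connected_charts_imp_arc:
  fixes S :: "'a::{complete_space,real_normed_vector} set"
  assumes charts: "\<And>x. x \<in> S \<Longrightarrow> open_chart_at S x \<or> end_chart_at S x"
    and "connected S" "x \<in> S" "y \<in> S" "x \<noteq> y"
  obtains g where "continuous_on {0..1} g" "inj_on g {0..1}" "g ` {0..1} \<subseteq> S" "g (0::real) = x" "g 1 = y"
proof -
  have "path_connected S" by (rule path_connected_charts[OF assms(1,2)])
  then obtain g where "arc g" "path_image g \<subseteq> S" "pathstart g = x" "pathfinish g = y"
    using assms(3-5) unfolding path_connected_arcwise by meson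
  then show ?thesis using that[of g]
    by (auto simp: arc_def path_def path_image_def pathstart_def pathfinish_def)
qed

text \<open>The trace of the half-open segment on \<open>C\<close> is relatively open, as initial
  segments are, and relatively closed, because \<open>\<alpha> s\<close> is not in \<open>C\<close>
  and so the compact arc has the same trace.\<close>

lemma connected_subset_initial_segment:
  fixes \<alpha> :: "real \<Rightarrow> 'a::metric_space"
  assumes charts: "\<And>x. x \<in> S \<Longrightarrow> open_chart_at S x \<or> end_chart_at S x"
    and end0: "end_chart_at S (\<alpha> 0)"
    and cont: "continuous_on {0..s} \<alpha>" and inj: "inj_on \<alpha> {0..s}"
    and sub: "\<alpha> ` {0..s} \<subseteq> S" and "0 < s"
    and C: "connected C" "C \<subseteq> S" "\<alpha> 0 \<in> C" "\<alpha> s \<notin> C"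
  shows "C \<subseteq> \<alpha> ` {0..<s}"
proof -
  have eq: "C \<inter> \<alpha> ` {0..<s} = C \<inter> \<alpha> ` {0..s}"
  proof -
    have "{0..s} = insert s {0..<s}" using \<open>0 < s\<close> by auto
    then show ?thesis using C(4) by auto
  qed
  have "openin (top_of_set C) (C \<inter> \<alpha> ` {0..<s})"
    using openin_initial_segment[OF charts end0 cont inj sub] C(2)
    unfolding openin_open by blast
  moreover have "compact (\<alpha> ` {0..s})" by (intro compact_continuous_image cont) auto
  then have "closedin (top_of_set C) (C \<inter> \<alpha> ` {0..<s})"
    unfolding eq by (simp add: closedin_closed_Int compact_imp_closed)
  moreover have "\<alpha> 0 \<in> C \<inter> \<alpha> ` {0..<s}" using C(3) \<open>0 < s\<close> by auto
  ultimately have "C \<inter> \<alpha> ` {0..<s} = C"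
    using C(1) unfolding connected_clopen by blast
  then show ?thesis by blast
qed

text \<open>In an open chart the curve parameter is an injective continuous function around an
  interior coordinate, hence monotone there; on one side it exceeds its value 1, although parameters
  never do.\<close>

lemma not_arc_ending_at_open_chart:
  fixes \<alpha> :: "real \<Rightarrow> 'a::metric_space"
  assumes cont: "continuous_on {0..1} \<alpha>" and inj: "inj_on \<alpha> {0..1}"
    and ch: "open_chart_at (\<alpha> ` {0..1}) (\<alpha> 1)"
  shows False
proof -
  let ?S = "\<alpha> ` {0..1}"
  obtain U a b f g where U: "open U" "\<alpha> 1 \<in> U" and hom: "homeomorphism (?S \<inter> U) {a<..<b::real} f g"
    using ch unfolding open_chart_at_def by blast
  obtain \<beta> where \<beta>: "homeomorphism {0..1} ?S \<alpha> \<beta>"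
    using homeomorphism_compact[OF _ cont _ inj, of ?S] by auto
  let ?c = "f (\<alpha> 1)"
  have c: "a < ?c" "?c < b" using hom U(2) by (auto simp: homeomorphism_def)
  obtain c1 where "a < c1" "c1 < ?c" using dense[OF c(1)] by blast
  moreover obtain c2 where "?c < c2" "c2 < b" using dense[OF c(2)] by blast
  ultimately have cc: "a < c1" "c1 < ?c" "?c < c2" "c2 < b" by auto
  have sub: "{c1..c2} \<subseteq> {a<..<b}" using cc by auto
  have gsub: "g ` {c1..c2} \<subseteq> ?S" using homeomorphism_image2[OF hom] image_mono[OF sub, of g] by simp
  have "continuous_on {c1..c2} (\<beta> \<circ> g)"
    by (intro continuous_on_compose continuous_on_subset[OF homeomorphism_cont2[OF hom] sub]
        continuous_on_subset[OF homeomorphism_cont2[OF \<beta>] gsub])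
  moreover have "inj_on (\<beta> \<circ> g) {c1..c2}"
  proof (rule comp_inj_on)
    show "inj_on g {c1..c2}"
      using homeomorphism_apply2[OF hom] sub by (intro inj_on_inverseI[of _ f]) blast
    show "inj_on \<beta> (g ` {c1..c2})"
      using homeomorphism_apply2[OF \<beta>] gsub by (intro inj_on_inverseI[of _ \<alpha>]) blast
  qed
  ultimately have "(\<beta> \<circ> g) ?c < (\<beta> \<circ> g) c2 \<or> (\<beta> \<circ> g) ?c < (\<beta> \<circ> g) c1"
    using continuous_inj_imp_mono[OF cc(2,3)] by blast
  moreover have "(\<beta> \<circ> g) ?c = 1"
    using homeomorphism_apply1[OF hom, of "\<alpha> 1"] homeomorphism_apply1[OF \<beta>, of 1] U(2) by simp
  moreover have "(\<beta> \<circ> g) r \<le> 1" if "r \<in> {c1..c2}" for r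
    using gsub homeomorphism_image2[OF \<beta>] that by fastforce
  ultimately show False using cc by (smt (verit) atLeastAtMost_iff)
qed

text \<open>The half-open arcs \<open>W x\<close> from \<open>p\<close> are relatively open, cover
  \<open>S\<close> and form a chain under inclusion. By compactness a single \<open>W x\<close>
  contains \<open>S\<close>, but it omits its own endpoint \<open>x\<close>.\<close>

lemma not_single_end_chart:
  fixes S :: "'a::{complete_space,real_normed_vector} set"
  assumes S: "compact S" "connected S"
    and p: "p \<in> S" "end_chart_at S p"
    and charts: "\<And>x. x \<in> S \<Longrightarrow> x \<noteq> p \<Longrightarrow> open_chart_at S x"
  shows False
proof -
  have charts': "\<And>x. x \<in> S \<Longrightarrow> open_chart_at S x \<or> end_chart_at S x"
    using charts p by blast
  have "\<forall>x\<in>S - {p}. \<exists>g. continuous_on {0..1} g \<and> inj_on g {0..1} \<and> g ` {0..1} \<subseteq> S \<and> g (0::real) = p \<and> g 1 = x"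
    using connected_charts_imp_arc[OF charts' S(2) p(1)] by (metis DiffE insertI1)
  then obtain \<alpha> where \<alpha>: "\<And>x. x \<in> S - {p} \<Longrightarrow> continuous_on {0..1} (\<alpha> x)"
    "\<And>x. x \<in> S - {p} \<Longrightarrow> inj_on (\<alpha> x) {0..1}" "\<And>x. x \<in> S - {p} \<Longrightarrow> \<alpha> x ` {0..1} \<subseteq> S"
    "\<And>x. x \<in> S - {p} \<Longrightarrow> \<alpha> x (0::real) = p" "\<And>x. x \<in> S - {p} \<Longrightarrow> \<alpha> x 1 = x"
    by metis
  define W where "W x = \<alpha> x ` {0..<1}" for x
  define P where "P x = \<alpha> x ` {0..1}" for x
  have W_open: "openin (top_of_set S) (W x)" if "x \<in> S - {p}" for x
    unfolding W_def using \<alpha>[OF that] p(2) by (intro openin_initial_segment charts') auto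
  \<comment> \<open>An arc from \<open>p\<close> that misses \<open>y\<close> is connected, so it is
    trapped in the arc to \<open>y\<close>.\<close>
  have P_sub: "P x \<subseteq> W y" if x: "x \<in> S - {p}" and y: "y \<in> S - {p}" and "y \<notin> P x" for x y
    unfolding W_def
  proof (rule connected_subset_initial_segment[OF charts'])
    show "connected (P x)" unfolding P_def by (intro connected_continuous_image \<alpha>(1) x) auto
    show "\<alpha> y 0 \<in> P x" unfolding P_def using \<alpha>(4) x y by (metis atLeastAtMost_iff image_eqI order_refl zero_le_one)
  qed (use \<alpha>[OF y] \<alpha>[OF x] p(2) that(3) in \<open>auto simp: P_def\<close>)
  have W_P: "P x = insert x (W x)" if "x \<in> S - {p}" for x
  proof -
    have "{0..1::real} = insert 1 {0..<1}" by auto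
    then show ?thesis unfolding P_def W_def using \<alpha>(5)[OF that] by simp
  qed
  have x_W: "x \<notin> W x" if x: "x \<in> S - {p}" for x
  proof
    assume "x \<in> W x"
    then obtain t where "t \<in> {0..<1}" "\<alpha> x t = \<alpha> x 1" unfolding W_def using \<alpha>(5)[OF x] by auto
    then show False using inj_onD[OF \<alpha>(2)[OF x], of t 1] by auto
  qed
  \<comment> \<open>Otherwise \<open>P x\<close> would be all of \<open>S\<close>, an arc ending at
    the open chart around \<open>x\<close>.\<close>
  have P_ne: "\<exists>y. y \<in> S - {p} \<and> y \<notin> P x" if "x \<in> S - {p}" for x
  proof (rule ccontr)
    assume "\<nexists>y. y \<in> S - {p} \<and> y \<notin> P x"
    moreover have "p \<in> P x" unfolding P_def using \<alpha>(4)[OF that] by (metis atLeastAtMost_iff image_eqI order_refl zero_le_one)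
    ultimately have "\<alpha> x ` {0..1} = S" using \<alpha>(3)[OF that] unfolding P_def by blast
    then show False using not_arc_ending_at_open_chart[OF \<alpha>(1,2)[OF that]] charts[of x] \<alpha>(5)[OF that] that
      by simp
  qed
  \<comment> \<open>If neither inclusion held, \<open>x\<close> and \<open>y\<close> would lie on
    each other's arcs. Cutting the arc to \<open>y\<close> at \<open>\<alpha> y s = x\<close> then
    traps \<open>W x\<close>, which is connected and avoids \<open>x\<close>, in the part before
    \<open>x\<close>.\<close>
  have nested: "W x \<subseteq> W y \<or> W y \<subseteq> W x" if x: "x \<in> S - {p}" and y: "y \<in> S - {p}" for x y
  proof (rule ccontr)
    assume n: "\<not> (W x \<subseteq> W y \<or> W y \<subseteq> W x)"
    then have "x \<noteq> y" by auto
    have "y \<in> P x" "x \<in> P y" using n P_sub x y W_P by blast+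
    then have "y \<in> W x" "x \<in> W y" using W_P x y \<open>x \<noteq> y\<close> by auto
    then obtain s where s: "0 \<le> s" "s < 1" "\<alpha> y s = x" unfolding W_def by auto
    have "s > 0" using s \<alpha>(4)[OF y] x by (cases "s = 0") auto
    have sub: "{0..s} \<subseteq> {0..1}" using s by auto
    have "W x \<subseteq> \<alpha> y ` {0..<s}"
    proof (rule connected_subset_initial_segment[OF charts'])
      show "connected (W x)" unfolding W_def
        by (intro connected_continuous_image continuous_on_subset[OF \<alpha>(1)[OF x]]) auto
      show "W x \<subseteq> S" using W_P x \<alpha>(3)[OF x] unfolding P_def by auto
      show "\<alpha> y 0 \<in> W x" unfolding W_def
        using \<alpha>(4) x y by (metis atLeastLessThan_iff image_eqI order_refl zero_less_one)
      show "\<alpha> y s \<notin> W x" using x_W x s by simp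
      show "continuous_on {0..s} (\<alpha> y)" "inj_on (\<alpha> y) {0..s}"
        using \<alpha>(1,2)[OF y] sub continuous_on_subset inj_on_subset by blast+
      show "\<alpha> y ` {0..s} \<subseteq> S" using \<alpha>(3)[OF y] sub by blast
    qed (use \<open>s > 0\<close> \<alpha>(4)[OF y] p(2) in auto)
    also have "\<dots> \<subseteq> W y" unfolding W_def using s by auto
    finally show False using n by blast
  qed
  obtain z where z: "z \<in> S - {p}"
  proof -
    obtain U a b f g where U: "open U" "p \<in> U" and hom: "homeomorphism (S \<inter> U) {a..<b::real} f g" "f p = a"
      using p(2) unfolding end_chart_at_def by blast
    have "a < b" using hom p U by (auto simp: homeomorphism_def)
    then have m: "(a + b)/2 \<in> {a..<b}" by auto
    then have "g ((a + b)/2) \<in> S \<inter> U" "f (g ((a+b)/2)) = (a+b)/2"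
      using hom(1) unfolding homeomorphism_def by blast+
    moreover from this have "g ((a+b)/2) \<noteq> p" using hom(2) \<open>a < b\<close> by force
    ultimately show ?thesis using that[of "g ((a+b)/2)"] by blast
  qed
  have cover: "S \<subseteq> \<Union>(W ` (S - {p}))"
  proof
    fix y assume "y \<in> S"
    show "y \<in> \<Union>(W ` (S - {p}))"
    proof (cases "y = p")
      case True
      then show ?thesis using z \<alpha>(4)[OF z] unfolding W_def
        by (metis UN_iff atLeastLessThan_iff image_eqI order_refl zero_less_one)
    next
      case False
      then show ?thesis using P_ne[of y] P_sub[of y] W_P[of y] \<open>y \<in> S\<close> by blast
    qed
  qed
  have "\<exists>D\<subseteq>W ` (S - {p}). finite D \<and> S \<subseteq> \<Union>D"
    using S(1)[unfolded compact_eq_openin_cover, rule_format, of "W ` (S - {p})"] cover W_open by auto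
  then obtain X where X: "X \<subseteq> S - {p}" "finite X" "S \<subseteq> \<Union>(W ` X)"
    by (metis finite_subset_image)
  then have "X \<noteq> {}" using z by auto
  have "\<exists>x\<in>X. \<Union>(W ` X) \<subseteq> W x" using X(2) \<open>X \<noteq> {}\<close> X(1)
  proof (induction X rule: finite_ne_induct)
    case (insert y X)
    then obtain x where "x \<in> X" "\<Union>(W ` X) \<subseteq> W x" by blast
    then show ?case using nested[of x y] insert.prems by blast
  qed auto
  then obtain x where "x \<in> X" "S \<subseteq> W x" using X(3) by blast
  then show False using x_W[of x] X(1) by blast
qed

text \<open>The arc from \<open>p\<close> to \<open>q\<close> is open without \<open>q\<close> and,
  read backwards, open without \<open>p\<close>. So the whole arc is open; being compact, it is all
  of \<open>S\<close>. Thus \<open>S\<close> is homeomorphic to \<open>{0..1}\<close> and inherits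
  its fixed point property.\<close>

lemma fixpoint_if_two_end_charts:
  fixes S :: "'a::{complete_space,real_normed_vector} set"
  assumes S: "connected S"
    and charts: "\<And>x. x \<in> S \<Longrightarrow> open_chart_at S x \<or> end_chart_at S x"
    and p: "p \<in> S" "end_chart_at S p" and q: "q \<in> S" "end_chart_at S q" and "p \<noteq> q"
    and f: "continuous_on S f" "f ` S \<subseteq> S"
  obtains x where "x \<in> S" "f x = x"
proof -
  obtain \<alpha> where \<alpha>: "continuous_on {0..1} \<alpha>" "inj_on \<alpha> {0..1}" "\<alpha> ` {0..1} \<subseteq> S" "\<alpha> (0::real) = p" "\<alpha> 1 = q"
    using connected_charts_imp_arc[OF charts S p(1) q(1) \<open>p \<noteq> q\<close>] by blast
  define \<beta> where "\<beta> = \<alpha> \<circ> (\<lambda>t. 1 - t)"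
  have im: "(\<lambda>t. 1 - t) ` {0..1::real} = {0..1}" "(\<lambda>t. 1 - t) ` {0..<1::real} = {0<..1}" by auto
  have \<beta>0: "continuous_on {0..1} \<beta>"
    unfolding \<beta>_def by (intro continuous_on_compose continuous_intros) (simp only: im \<alpha>(1))
  have \<beta>1: "inj_on \<beta> {0..1}"
    unfolding \<beta>_def by (rule comp_inj_on) (simp_all only: im \<alpha>(2), simp)
  have \<beta>: "continuous_on {0..1} \<beta>" "inj_on \<beta> {0..1}" "\<beta> ` {0..1} \<subseteq> S" "\<beta> 0 = q"
    using \<beta>0 \<beta>1 \<alpha> im(1) by (auto simp: \<beta>_def)
  have "openin (top_of_set S) (\<alpha> ` {0..<1})"
    using \<alpha> p(2) by (intro openin_initial_segment charts) auto
  moreover have "openin (top_of_set S) (\<beta> ` {0..<1})"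
    using \<beta> q(2) by (intro openin_initial_segment charts) auto
  then have "openin (top_of_set S) (\<alpha> ` {0<..1})"
    unfolding \<beta>_def image_comp[symmetric] im .
  ultimately have "openin (top_of_set S) (\<alpha> ` {0..<1} \<union> \<alpha> ` {0<..1})" by blast
  moreover have "{0..<1} \<union> {0<..1} = {0..1::real}" by auto
  ultimately have "openin (top_of_set S) (\<alpha> ` {0..1})" by (simp add: image_Un[symmetric])
  moreover have "closedin (top_of_set S) (\<alpha> ` {0..1})"
    using \<alpha>(3) by (intro closed_subset compact_imp_closed compact_continuous_image \<alpha>(1)) auto
  ultimately have eq: "\<alpha> ` {0..1} = S"
    using S unfolding connected_clopen by fastforce
  then obtain \<gamma> where "homeomorphism {0..1} S \<alpha> \<gamma>"
    using homeomorphism_compact[OF _ \<alpha>(1) _ \<alpha>(2), of S] by auto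
  then have "{0..1::real} homeomorphic S" unfolding homeomorphic_def by blast
  then have "(\<forall>f. continuous_on {0..1::real} f \<and> f \<in> {0..1} \<rightarrow> {0..1} \<longrightarrow> (\<exists>x\<in>{0..1}. f x = x)) =
      (\<forall>f. continuous_on S f \<and> f \<in> S \<rightarrow> S \<longrightarrow> (\<exists>y\<in>S. f y = y))"
    by (rule homeomorphic_fixpoint_property)
  moreover have "\<exists>x\<in>{0..1}. f x = x" if "continuous_on {0..1} f" "f \<in> {0..1} \<rightarrow> {0..1}" for f :: "real \<Rightarrow> real"
    using brouwer[of "{0..1}" f] that by (metis atLeastAtMost_iff compact_Icc convex_real_interval(5) empty_iff order_refl zero_le_one)
  ultimately show ?thesis using f that by blast
qed

section \<open>Fibres of maps of constant rank\<close>

text \<open>The orthogonal complement \<open>?C\<close> of the kernel inside \<open>S\<close> maps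
  injectively onto the whole image. The form relative to a subspace serves for ranges and kernels of
  derivatives.\<close>

lemma dim_image_plus_kernel:
  fixes f :: "'a::euclidean_space \<Rightarrow> 'b::euclidean_space"
  assumes f: "linear f" and S: "subspace S"
  shows "dim (f ` S) + dim {x \<in> S. f x = 0} = dim S"
proof -
  interpret f: linear f by (rule f)
  let ?A = "{x \<in> S. f x = 0}"
  let ?C = "{y \<in> S. \<forall>x\<in>?A. orthogonal x y}"
  have A: "subspace ?A"
    using S by (auto simp: subspace_def f.add f.scale f.zero)
  have C: "subspace ?C"
    using S by (auto simp: subspace_def orthogonal_clauses)
  have "inj_on f ?C"
  proof (rule inj_onI)
    fix x y assume xy: "x \<in> ?C" "y \<in> ?C" "f x = f y"
    then have "x - y \<in> ?C" using C subspace_diff by blast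
    moreover from this have "x - y \<in> ?A" using xy by (simp add: f.diff)
    ultimately have "orthogonal (x - y) (x - y)" by blast
    then show "x = y" by (simp add: orthogonal_self)
  qed
  then have "dim (f ` ?C) = dim ?C"
    using C f by (intro dim_image_eq) (simp_all only: span_eq_iff[THEN iffD2, OF C])
  moreover have "f ` ?C = f ` S"
  proof
    show "f ` S \<subseteq> f ` ?C"
    proof
      fix w assume "w \<in> f ` S"
      then obtain x where x: "x \<in> S" "w = f x" by blast
      obtain y z where yz: "x = y + z" "y \<in> span ?A" "\<And>w. w \<in> span ?A \<Longrightarrow> orthogonal z w"
        by (rule orthogonal_subspace_decomp_exists[of ?A x]) (rule that; assumption)
      have y: "y \<in> ?A" using yz(2) by (simp only: span_eq_iff[THEN iffD2, OF A])
      have "z = x - y" using yz(1) by simp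
      then have "z \<in> S" using x(1) y subspace_diff[OF S] by simp
      moreover have "\<forall>a\<in>?A. orthogonal a z" using yz(3) by (meson orthogonal_commute span_base)
      moreover have "f z = w" using yz(1) y x by (simp add: f.add)
      ultimately show "w \<in> f ` ?C" by blast
    qed
  qed auto
  moreover have "dim ?C + dim ?A = dim S"
    by (rule dim_subspace_orthogonal_to_vectors) (use A S in auto)
  ultimately show ?thesis by simp
qed

text \<open>With \<open>A\<close> the derivative of \<open>F\<close> at \<open>q\<close>, the map \<open>A\<^sup>T \<circ> F + l\<close> is a local diffeomorphism at \<open>q\<close>.
  Its components lie in the orthogonal spaces \<open>range A\<^sup>T\<close> and \<open>ker A\<close>, and the rank condition makes
  \<open>A\<^sup>T\<close> injective on the range of every nearby derivative of \<open>F\<close>.\<close>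

lemma constant_rank_fibre:
  fixes F :: "'e::euclidean_space \<Rightarrow> 'f::euclidean_space" and l :: "'e \<Rightarrow> 'e"
  assumes F': "\<And>x. (F has_derivative blinfun_apply (F' x)) (at x)"
    and contF': "continuous_on UNIV F'"
    and l': "\<And>x. (l has_derivative blinfun_apply (l' x)) (at x)"
    and contl': "continuous_on UNIV l'"
    and U: "open U" "q \<in> U"
    and rank: "\<And>x. x \<in> U \<Longrightarrow> dim (range (blinfun_apply (F' x))) \<le> dim (range (blinfun_apply (F' q)))"
    and lK: "\<And>x. blinfun_apply (F' q) (l x) = 0"
    and inj: "\<And>v. blinfun_apply (F' q) v = 0 \<Longrightarrow> blinfun_apply (l' q) v = 0 \<Longrightarrow> v = 0"
  obtains N \<delta> \<gamma> where "open N" "q \<in> N" "0 < \<delta>"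
    "homeomorphism {x \<in> N. F x = F q} {k. blinfun_apply (F' q) k = 0 \<and> dist (l q) k < \<delta>} l \<gamma>"
proof -
  define A where "A = blinfun_apply (F' q)"
  define At where "At = adjoint A"
  define K where "K = {k. A k = 0}"
  have linA: "linear A" unfolding A_def by (simp add: blinfun.bounded_linear_right bounded_linear.linear)
  have linAt: "linear At" unfolding At_def by (rule adjoint_linear[OF linA])
  have bAt: "bounded_linear At" using linAt by (simp add: linear_conv_bounded_linear)
  have adj: "At y \<bullet> x = y \<bullet> A x" for x y unfolding At_def by (rule adjoint_clauses(2)[OF linA])
  have subK: "subspace K" unfolding K_def by (rule linear_subspace_kernel[OF linA])
  \<comment> \<open>The range of \<open>At\<close> is orthogonal to the kernel \<open>K\<close> of
    \<open>A\<close>. This separates the two components of \<open>\<Phi>\<close>.\<close>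
  have At_K: "At w = 0" if "At w \<in> K" for w
    using adj[of w "At w"] that by (simp add: K_def)
  have l'K: "blinfun_apply (l' x) v \<in> K" for x v
  proof -
    have "((\<lambda>x. A (l x)) has_derivative (\<lambda>v. A (blinfun_apply (l' x) v))) (at x)"
      unfolding A_def by (rule bounded_linear.has_derivative[OF blinfun.bounded_linear_right l'])
    moreover have "(\<lambda>x. A (l x)) = (\<lambda>x. 0)" using lK by (simp add: A_def)
    ultimately have "(\<lambda>v. A (blinfun_apply (l' x) v)) = (\<lambda>v. 0)"
      by (metis has_derivative_const has_derivative_unique)
    then show ?thesis unfolding K_def by (metis mem_Collect_eq)
  qed
  define \<Phi> where "\<Phi> x = At (F x) + l x" for x
  define \<Phi>' where "\<Phi>' x = (Blinfun At o\<^sub>L F' x) + l' x" for x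
  have \<Phi>'_apply: "blinfun_apply (\<Phi>' x) v = At (blinfun_apply (F' x) v) + blinfun_apply (l' x) v" for x v
    unfolding \<Phi>'_def by (simp add: blinfun.add_left bounded_linear_Blinfun_apply[OF bAt])
  have D\<Phi>: "(\<Phi> has_derivative blinfun_apply (\<Phi>' x)) (at x)" for x
    unfolding \<Phi>_def \<Phi>'_apply[abs_def]
    by (intro has_derivative_add l' bounded_linear.has_derivative[OF bAt F'])
  have cont\<Phi>': "continuous_on U \<Phi>'"
    unfolding \<Phi>'_def
    by (intro continuous_on_add bounded_bilinear.continuous_on[OF bounded_bilinear_blinfun_compose]
        continuous_on_const continuous_on_subset[OF contF'] continuous_on_subset[OF contl']) auto
  have "inj (blinfun_apply (\<Phi>' q))"
  proof (subst linear_injective_0)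
    show "linear (blinfun_apply (\<Phi>' q))" by (simp add: blinfun.bounded_linear_right bounded_linear.linear)
    show "\<forall>v. blinfun_apply (\<Phi>' q) v = 0 \<longrightarrow> v = 0"
    proof (intro allI impI)
      fix v assume "blinfun_apply (\<Phi>' q) v = 0"
      then have eq: "At (A v) = - blinfun_apply (l' q) v"
        by (simp add: \<Phi>'_apply A_def eq_neg_iff_add_eq_0)
      then have "At (A v) \<in> K" using l'K[of q v] subspace_neg[OF subK] by metis
      then have 0: "At (A v) = 0" by (rule At_K)
      then have "A v \<bullet> A v = 0" using adj[of "A v" v] by simp
      then show "v = 0" using inj[of v] eq 0 by (simp add: A_def)
    qed
  qed
  then obtain g0 where g0: "linear g0" "g0 \<circ> blinfun_apply (\<Phi>' q) = id"
    using linear_injective_left_inverse[of "blinfun_apply (\<Phi>' q)"]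
    by (auto simp: blinfun.bounded_linear_right bounded_linear.linear)
  then have bg0: "bounded_linear g0" by (simp add: linear_conv_bounded_linear)
  have inv: "Blinfun g0 o\<^sub>L \<Phi>' q = id_blinfun"
    using g0(2) by (intro blinfun_eqI) (simp add: bounded_linear_Blinfun_apply[OF bg0] fun_eq_iff)
  obtain W V g g' where W: "open W" "W \<subseteq> U" "q \<in> W" and V: "open V" "\<Phi> q \<in> V"
    and hom: "homeomorphism W V \<Phi> g"
    and g': "\<And>y. y \<in> V \<Longrightarrow> (g has_derivative (g' y)) (at y)"
    and g'_eq: "\<And>y. y \<in> V \<Longrightarrow> g' y = Hilbert_Choice.inv (blinfun_apply (\<Phi>'(g y)))"
    and bij: "\<And>y. y \<in> V \<Longrightarrow> bij (blinfun_apply (\<Phi>'(g y)))"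
    using inverse_function_theorem[OF U(1) D\<Phi> cont\<Phi>' U(2) inv] by metis
  obtain \<delta> where \<delta>: "0 < \<delta>" "ball (\<Phi> q) \<delta> \<subseteq> V" using V open_contains_ball by blast
  define \<gamma> where "\<gamma> k = g (At (F q) + k)" for k
  define D where "D = {k. A k = 0 \<and> dist (l q) k < \<delta>}"
  have inV: "At (F q) + k \<in> V" if "k \<in> D" for k
  proof -
    have "At (F q) + k \<in> ball (\<Phi> q) \<delta>" using that by (simp add: D_def \<Phi>_def)
    then show ?thesis using \<delta>(2) by blast
  qed
  have gW: "g y \<in> W" "\<Phi> (g y) = y" if "y \<in> V" for y
    using that homeomorphism_image2[OF hom] homeomorphism_apply2[OF hom] by auto
  \<comment> \<open>Dimension count: as \<open>\<Phi>' x\<close> is onto, the image under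
    \<open>At\<close> of the range of \<open>F' x\<close>, together with \<open>K\<close>, spans
    everything, so this image has dimension at least the rank of \<open>A\<close>. The rank bound
    leaves no room for \<open>At\<close> to lose a dimension.\<close>
  have inj_range: "At (blinfun_apply (F' x) w) = 0 \<Longrightarrow> blinfun_apply (F' x) w = 0"
    if x: "x = g y" "y \<in> V" for x y w
  proof -
    let ?R = "range (blinfun_apply (F' x))"
    have linx: "linear (blinfun_apply (F' x))" by (simp add: blinfun.bounded_linear_right bounded_linear.linear)
    have subR: "subspace ?R" using linear_subspace_image[OF linx subspace_UNIV] .
    have subAR: "subspace (At ` ?R)" using linear_subspace_image[OF linAt subR] .
    have sums: "UNIV \<subseteq> {a + b |a b. a \<in> At ` ?R \<and> b \<in> K}"
    proof
      fix z
      obtain v where "z = blinfun_apply (\<Phi>' x) v"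
        using bij[OF x(2)] x(1) unfolding bij_def by (metis surjD)
      then show "z \<in> {a + b |a b. a \<in> At ` ?R \<and> b \<in> K}"
        unfolding \<Phi>'_apply using l'K[of x v] by blast
    qed
    have "DIM('e) \<le> dim {a + b |a b. a \<in> At ` ?R \<and> b \<in> K}"
      using dim_subset[OF sums] by (simp only: dim_UNIV)
    also have "\<dots> \<le> dim (At ` ?R) + dim K"
      using dim_sums_Int[OF subAR subK] by linarith
    finally have "DIM('e) \<le> dim (At ` ?R) + dim K" .
    moreover have "dim (range A) + dim K = DIM('e)"
      using dim_image_plus_kernel[OF linA subspace_UNIV] by (simp add: K_def)
    moreover have "dim ?R \<le> dim (range A)"
      using rank[of x] gW(1)[OF x(2)] x(1) W(2) by (auto simp: A_def)
    moreover have "dim (At ` ?R) + dim {z \<in> ?R. At z = 0} = dim ?R"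
      by (rule dim_image_plus_kernel[OF linAt subR])
    ultimately have "dim {z \<in> ?R. At z = 0} = 0" by linarith
    then have "{z \<in> ?R. At z = 0} \<subseteq> {0}" by simp
    then show "At (blinfun_apply (F' x) w) = 0 \<Longrightarrow> blinfun_apply (F' x) w = 0" by blast
  qed
  have l\<gamma>: "l (\<gamma> k) = k" if "k \<in> D" for k
  proof -
    have "At (F (\<gamma> k)) + l (\<gamma> k) = At (F q) + k"
      using gW(2)[OF inV[OF that]] by (simp add: \<gamma>_def \<Phi>_def)
    then have eq: "At (F (\<gamma> k) - F q) = k - l (\<gamma> k)"
      by (simp add: linear_diff[OF linAt] algebra_simps)
    have "k - l (\<gamma> k) \<in> K"
      using that lK by (intro subspace_diff[OF subK]) (auto simp: D_def K_def A_def)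
    then show ?thesis using At_K eq by (metis right_minus_eq)
  qed
  have lqD: "l q \<in> D" using \<delta>(1) lK by (simp add: D_def A_def)
  have \<gamma>lq: "\<gamma> (l q) = q"
    using homeomorphism_apply1[OF hom W(3)] by (simp add: \<gamma>_def \<Phi>_def)
  \<comment> \<open>On the segment from \<open>l q\<close> to \<open>k\<close>, the value of
    \<open>\<Phi>\<close> moves in directions of \<open>K\<close> only. So \<open>At\<close> of the
    derivative of \<open>F\<close> along \<open>\<gamma>\<close> lies both in \<open>K\<close> and
    in the range of \<open>At\<close>; it vanishes, and by \<open>inj_range\<close> the derivative
    does too.\<close>
  have F\<gamma>: "F (\<gamma> k) = F q" if k: "k \<in> D" for k
  proof -
    define c where "c t = l q + t *\<^sub>R (k - l q)" for t
    have cD: "c t \<in> D" if "t \<in> {0..1}" for t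
    proof -
      have "A (c t) = 0" unfolding c_def
        using k lK by (simp add: blinfun.add_right blinfun.scaleR_right blinfun.diff_right D_def A_def)
      moreover have "dist (l q) (c t) = t * dist (l q) k"
        using that unfolding c_def dist_norm by (simp add: norm_minus_commute)
      moreover have "t * dist (l q) k \<le> 1 * dist (l q) k" using that by (intro mult_right_mono) auto
      ultimately show ?thesis using k by (simp add: D_def)
    qed
    have "((\<lambda>t. F (\<gamma> (c t))) has_derivative (\<lambda>h. 0)) (at t within {0..1})" if t: "t \<in> {0..1}" for t
    proof -
      let ?y = "At (F q) + c t"
      have y: "?y \<in> V" using inV[OF cD[OF t]] .
      define w where "w = g' ?y (k - l q)"
      have "((\<lambda>t. At (F q) + c t) has_derivative (\<lambda>h. h *\<^sub>R (k - l q))) (at t within {0..1})"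
        unfolding c_def by (auto intro!: derivative_eq_intros)
      then have "((\<lambda>t. g (At (F q) + c t)) has_derivative (\<lambda>h. g' ?y (h *\<^sub>R (k - l q)))) (at t within {0..1})"
        by (rule has_derivative_compose) (rule g'[OF y])
      then have "((\<lambda>t. F (\<gamma> (c t))) has_derivative
          (\<lambda>h. blinfun_apply (F' (g ?y)) (g' ?y (h *\<^sub>R (k - l q))))) (at t within {0..1})"
        unfolding \<gamma>_def by (rule has_derivative_compose) (rule F')
      moreover have "blinfun_apply (F' (g ?y)) (g' ?y (h *\<^sub>R (k - l q))) = 0" for h
      proof -
        let ?v = "h *\<^sub>R (k - l q)"
        have "blinfun_apply (\<Phi>' (g ?y)) (g' ?y ?v) = ?v"
          unfolding g'_eq[OF y] using bij[OF y] by (simp add: bij_is_surj surj_f_inv_f)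
        then have "At (blinfun_apply (F' (g ?y)) (g' ?y ?v)) = ?v - blinfun_apply (l' (g ?y)) (g' ?y ?v)"
          unfolding \<Phi>'_apply by (simp add: eq_diff_eq)
        moreover have "?v \<in> K" using k lK
          by (intro subspace_scale[OF subK] subspace_diff[OF subK]) (auto simp: D_def K_def A_def)
        ultimately have "At (blinfun_apply (F' (g ?y)) (g' ?y ?v)) \<in> K"
          using l'K subspace_diff[OF subK] by metis
        then show ?thesis using At_K inj_range[OF refl y] by blast
      qed
      ultimately show ?thesis by simp
    qed
    then obtain b where "\<forall>t\<in>{0..1}. F (\<gamma> (c t)) = b"
      using has_derivative_zero_constant[of "{0..1::real}" "\<lambda>t. F (\<gamma> (c t))"] by auto
    then have "F (\<gamma> (c 0)) = F (\<gamma> (c 1))" by simp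
    then show ?thesis by (simp add: c_def \<gamma>lq)
  qed
  have contl: "continuous_on UNIV l"
    by (intro continuous_at_imp_continuous_on ballI has_derivative_continuous[OF l'])
  define N where "N = W \<inter> l -` ball (l q) \<delta>"
  have "open N"
    unfolding N_def using contl W(1) by (simp add: continuous_on_open_vimage open_Int open_vimage)
  moreover have "q \<in> N" using W(3) \<delta>(1) by (simp add: N_def)
  moreover have "homeomorphism {x \<in> N. F x = F q} D l \<gamma>"
    unfolding homeomorphism_def
  proof (intro conjI ballI)
    show "continuous_on {x \<in> N. F x = F q} l" using contl continuous_on_subset by blast
    have "continuous_on ((\<lambda>k. At (F q) + k) ` D) g"
      by (rule continuous_on_subset[OF homeomorphism_cont2[OF hom]]) (use inV in auto)
    then show "continuous_on D \<gamma>" unfolding \<gamma>_def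
      by (rule continuous_on_compose2) (auto intro!: continuous_intros)
    have lD: "l x \<in> D" if "x \<in> {x \<in> N. F x = F q}" for x
      using that lK by (simp add: N_def D_def A_def)
    have \<gamma>N: "\<gamma> k \<in> {x \<in> N. F x = F q}" if "k \<in> D" for k
      using that gW(1)[OF inV[OF that]] l\<gamma>[OF that] F\<gamma>[OF that] by (auto simp: N_def D_def \<gamma>_def)
    show \<gamma>l: "\<gamma> (l x) = x" if "x \<in> {x \<in> N. F x = F q}" for x
    proof -
      have "At (F q) + l x = \<Phi> x" "x \<in> W" using that by (simp_all add: \<Phi>_def N_def)
      then show ?thesis unfolding \<gamma>_def using homeomorphism_apply1[OF hom] by simp
    qed
    show "l (\<gamma> k) = k" if "k \<in> D" for k using l\<gamma>[OF that] .
    show "l ` {x \<in> N. F x = F q} = D" using lD \<gamma>N l\<gamma> by (force simp: image_iff)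
    show "\<gamma> ` D = {x \<in> N. F x = F q}" using lD \<gamma>N \<gamma>l by (force simp: image_iff)
  qed
  ultimately show ?thesis using that \<delta>(1) unfolding D_def A_def by blast
qed

text \<open>With a projection \<open>\<pi>\<close> onto the kernel as chart, the fibre near
  \<open>q\<close> is a copy of a ball in the kernel, which contains a segment in direction
  \<open>u\<close>.\<close>

lemma infinite_fibre:
  fixes F :: "'e::euclidean_space \<Rightarrow> 'f::euclidean_space"
  assumes F': "\<And>x. (F has_derivative blinfun_apply (F' x)) (at x)"
    and contF': "continuous_on UNIV F'"
    and U: "open U" "q \<in> U"
    and rank: "\<And>x. x \<in> U \<Longrightarrow> dim (range (blinfun_apply (F' x))) \<le> dim (range (blinfun_apply (F' q)))"
    and u: "blinfun_apply (F' q) u = 0" "u \<noteq> 0"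
  shows "infinite {x. F x = F q}"
proof -
  let ?K = "{k. blinfun_apply (F' q) k = 0}"
  have linA: "linear (blinfun_apply (F' q))" by (simp add: blinfun.bounded_linear_right bounded_linear.linear)
  have K: "subspace ?K" by (rule linear_subspace_kernel[OF linA])
  obtain \<pi> where \<pi>: "range \<pi> \<subseteq> ?K" "linear \<pi>" "\<forall>v\<in>?K. \<pi> v = v"
    using real_vector.linear_exists_left_inverse_on[OF linear_id K] by auto
  have b\<pi>: "bounded_linear \<pi>" using \<pi>(2) by (simp add: linear_conv_bounded_linear)
  obtain N \<delta> \<gamma> where N: "open N" "q \<in> N" "0 < \<delta>"
    and hom: "homeomorphism {x \<in> N. F x = F q} {k. blinfun_apply (F' q) k = 0 \<and> dist (\<pi> q) k < \<delta>} \<pi> \<gamma>"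
  proof (rule constant_rank_fibre[OF F' contF', of \<pi> "\<lambda>_. Blinfun \<pi>" U q])
    show "(\<pi> has_derivative blinfun_apply (Blinfun \<pi>)) (at x)" for x
      using bounded_linear_imp_has_derivative[OF b\<pi>] by (simp add: bounded_linear_Blinfun_apply[OF b\<pi>])
    show "v = 0" if "blinfun_apply (F' q) v = 0" "blinfun_apply (Blinfun \<pi>) v = 0" for v
      using that \<pi>(3) by (simp add: bounded_linear_Blinfun_apply[OF b\<pi>])
    show "blinfun_apply (F' q) (\<pi> x) = 0" for x using \<pi>(1) by blast
  qed (use U rank in \<open>auto simp: bounded_linear_Blinfun_apply[OF b\<pi>] intro!: continuous_intros\<close>)
  let ?D = "{k. blinfun_apply (F' q) k = 0 \<and> dist (\<pi> q) k < \<delta>}"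
  define c where "c t = \<pi> q + t *\<^sub>R u" for t
  have "inj_on c {0<..<\<delta> / norm u}" using u(2) by (auto simp: c_def inj_on_def)
  moreover have "infinite {0<..<\<delta> / norm u}" using N(3) u(2) by simp
  ultimately have "infinite (c ` {0<..<\<delta> / norm u})" by (simp add: finite_image_iff)
  moreover have "c ` {0<..<\<delta> / norm u} \<subseteq> ?D"
  proof safe
    fix t assume t: "t \<in> {0<..<\<delta> / norm u}"
    have "blinfun_apply (F' q) (\<pi> q) = 0" using \<pi>(1) by blast
    then show "blinfun_apply (F' q) (c t) = 0"
      unfolding c_def using u(1) by (simp add: blinfun.add_right blinfun.scaleR_right)
    show "dist (\<pi> q) (c t) < \<delta>"
      using t u(2) by (simp add: c_def dist_norm pos_less_divide_eq)
  qed
  ultimately have "infinite ?D" using finite_subset by blast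
  then have "infinite {x \<in> N. F x = F q}"
    using homeomorphism_image1[OF hom] by (metis finite_imageI)
  then show ?thesis by (rule contrapos_nn) (auto elim: finite_subset[rotated])
qed

text \<open>Multiplying \<open>f\<close> by a unit vector \<open>u\<close> of the kernel puts its
  values where \<open>constant_rank_fibre\<close> expects them; the inner product with
  \<open>u\<close> reads the coordinate back. As \<open>f\<close> is arbitrary, it can be the length
  of the deleted edge.\<close>

lemma one_dimensional_fibre:
  fixes F :: "'e::euclidean_space \<Rightarrow> 'f::euclidean_space" and f :: "'e \<Rightarrow> real"
  assumes F': "\<And>x. (F has_derivative blinfun_apply (F' x)) (at x)"
    and contF': "continuous_on UNIV F'"
    and f': "\<And>x. (f has_derivative blinfun_apply (f' x)) (at x)"
    and contf': "continuous_on UNIV f'"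
    and U: "open U" "q \<in> U"
    and rank: "\<And>x. x \<in> U \<Longrightarrow> dim (range (blinfun_apply (F' x))) \<le> dim (range (blinfun_apply (F' q)))"
    and K: "dim {v. blinfun_apply (F' q) v = 0} = 1"
    and inj: "\<And>v. blinfun_apply (F' q) v = 0 \<Longrightarrow> blinfun_apply (f' q) v = 0 \<Longrightarrow> v = 0"
  obtains N \<delta> \<gamma> where "open N" "q \<in> N" "0 < \<delta>"
    "homeomorphism {x \<in> N. F x = F q} {f q - \<delta><..<f q + \<delta>} f \<gamma>"
proof -
  let ?K = "{v. blinfun_apply (F' q) v = 0}"
  have linA: "linear (blinfun_apply (F' q))" by (simp add: blinfun.bounded_linear_right bounded_linear.linear)
  have subK: "subspace ?K" by (rule linear_subspace_kernel[OF linA])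
  have "\<not> ?K \<subseteq> {0}" using K dim_eq_0[of ?K] by linarith
  then obtain v where v: "v \<in> ?K" "v \<noteq> 0" by blast
  define u where "u = v /\<^sub>R norm v"
  have u: "u \<in> ?K" "norm u = 1"
    using v by (auto simp: u_def blinfun.scaleR_right)
  have span: "?K = span {u}"
  proof (rule sym, rule subspace_dim_equal)
    have "u \<noteq> 0" using u(2) by auto
    then show "dim ?K \<le> dim (span {u})" using K by (simp add: dim_insert)
    show "span {u} \<subseteq> ?K" by (intro span_minimal subK) (use u in simp)
  qed (use subK in auto)
  define l where "l x = f x *\<^sub>R u" for x
  define l' where "l' x = blinfun_scaleR_left u o\<^sub>L f' x" for x
  obtain N \<delta> \<gamma> where N: "open N" "q \<in> N" "0 < \<delta>"
    and hom: "homeomorphism {x \<in> N. F x = F q} {k. blinfun_apply (F' q) k = 0 \<and> dist (l q) k < \<delta>} l \<gamma>"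
  proof (rule constant_rank_fibre[OF F' contF', of l l' U q])
    show "(l has_derivative blinfun_apply (l' x)) (at x)" for x
      unfolding l_def l'_def by (auto intro!: derivative_eq_intros f')
    show "continuous_on UNIV l'" unfolding l'_def
      by (intro bounded_bilinear.continuous_on[OF bounded_bilinear_blinfun_compose] continuous_on_const contf')
    show "blinfun_apply (F' q) (l x) = 0" for x
      using u(1) by (simp add: l_def blinfun.scaleR_right)
    show "v = 0" if "blinfun_apply (F' q) v = 0" "blinfun_apply (l' q) v = 0" for v
      using inj that u(2) by (auto simp: l'_def)
  qed (use U rank in auto)
  let ?D = "{k. blinfun_apply (F' q) k = 0 \<and> dist (l q) k < \<delta>}"
  let ?I = "{f q - \<delta><..<f q + \<delta>}"
  have "u \<bullet> u = 1" using u(2) by (simp add: dot_square_norm)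
  have D: "?D = (\<lambda>t. t *\<^sub>R u) ` ?I"
  proof -
    have "dist (l q) (t *\<^sub>R u) = \<bar>f q - t\<bar>" for t
      by (simp add: l_def dist_norm u(2) flip: scaleR_diff_left)
    moreover have "?D = {k \<in> range (\<lambda>t. t *\<^sub>R u). dist (l q) k < \<delta>}"
      using span by (auto simp: span_singleton)
    ultimately show ?thesis by (auto simp: abs_less_iff)
  qed
  have "homeomorphism ?D ?I (\<lambda>k. k \<bullet> u) (\<lambda>t. t *\<^sub>R u)"
    unfolding D homeomorphism_def using \<open>u \<bullet> u = 1\<close> by (auto intro!: continuous_intros simp: image_image)
  from homeomorphism_compose[OF hom this]
  have "homeomorphism {x \<in> N. F x = F q} ?I ((\<lambda>k. k \<bullet> u) \<circ> l) (\<gamma> \<circ> (\<lambda>t. t *\<^sub>R u))" .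
  moreover have "(\<lambda>k. k \<bullet> u) \<circ> l = f" using \<open>u \<bullet> u = 1\<close> by (auto simp: l_def)
  ultimately show ?thesis using that N by auto
qed

section \<open>Isometries and support functionals\<close>

lemma isometry_compose: "isometry f \<Longrightarrow> isometry g \<Longrightarrow> isometry (f \<circ> g)"
  by (auto simp: isometry_def intro: bij_comp)

lemma isometry_inv: "isometry f \<Longrightarrow> isometry (inv f)"
  unfolding isometry_def by (metis bij_imp_bij_inv bij_inv_eq_iff)

lemma isometry_reflection: "isometry (\<lambda>x. z - x :: 'a::real_normed_vector)"
  unfolding isometry_def
proof (intro conjI allI)
  show "bij (\<lambda>x. z - x)" by (rule o_bij[of "\<lambda>x. z - x"]) auto
  show "dist (z - x) (z - y) = dist x y" for x y
    by (simp add: dist_norm norm_minus_commute)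
qed

text \<open>The proof of the Mazur--Ulam theorem by reflections: composing with reflections in the midpoint
  doubles its displacement, while all displacements are bounded by the distance of the two points.\<close>

lemma isometry_fixing_two_points_fixes_midpoint:
  fixes a b :: "'a::real_normed_vector"
  assumes "isometry g" "g a = a" "g b = b"
  shows "g (midpoint a b) = midpoint a b"
proof -
  define z where "z = midpoint a b"
  have zz: "z + z = a + b" unfolding z_def by (simp add: midpoint_plus_self)
  have bound: "2 ^ n * dist (g z) z \<le> dist a b" if "isometry g" "g a = a" "g b = b" for n g
    using that
  proof (induction n arbitrary: g)
    case 0
    have "dist (g z) z \<le> dist (g z) (g a) + dist a z" using 0(2) dist_triangle by metis
    also have "\<dots> = dist z a + dist a z" using 0(1) by (simp add: isometry_def)
    also have "\<dots> = dist a b" by (simp add: z_def dist_midpoint dist_commute)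
    finally show ?case by simp
  next
    case (Suc n)
    let ?r = "\<lambda>x. (a + b) - x"
    have bij: "bij g" using Suc.prems by (simp add: isometry_def)
    have inv: "isometry (inv g)" using Suc.prems by (simp add: isometry_inv)
    define h where "h = ?r \<circ> (inv g \<circ> (?r \<circ> g))"
    have "isometry h" unfolding h_def
      by (intro isometry_compose isometry_reflection inv Suc.prems)
    moreover have "h a = a" "h b = b"
      using Suc.prems bij by (auto simp: h_def bij_is_inj inv_f_eq)
    ultimately have "2 ^ n * dist (h z) z \<le> dist a b" by (rule Suc.IH)
    moreover have "dist (h z) z = 2 * dist (g z) z"
    proof -
      have "dist (h z) z = norm ((a + b) - inv g (?r (g z)) - z)" by (simp add: h_def dist_norm)
      also have "(a + b) - inv g (?r (g z)) - z = z - inv g (?r (g z))"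
        by (simp add: zz[symmetric])
      also have "norm \<dots> = dist (inv g (g z)) (inv g (?r (g z)))"
        using bij by (simp add: dist_norm bij_is_inj)
      also have "\<dots> = dist (g z) (?r (g z))" using inv by (simp add: isometry_def)
      also have "\<dots> = norm (2 *\<^sub>R (g z - z))"
        by (simp add: dist_norm zz[symmetric] scaleR_2 algebra_simps)
      finally show ?thesis by (simp add: dist_norm)
    qed
    ultimately show ?case by simp
  qed
  have "dist (g z) z = 0"
  proof (rule ccontr)
    assume "dist (g z) z \<noteq> 0"
    then have pos: "0 < dist (g z) z" by simp
    obtain n where "dist a b / dist (g z) z < 2 ^ n" using real_arch_pow[of 2] by auto
    then show False using bound[OF assms, of n] pos by (simp add: divide_less_eq)
  qed
  then show ?thesis by (simp add: z_def)
qed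

text \<open>Interleaving \<open>f\<close> and its inverse with the reflections in the two midpoints
  gives an isometry \<open>h\<close> fixing \<open>a\<close> and \<open>b\<close>, hence their
  midpoint. This makes the image of the midpoint its own reflection in the midpoint of the
  images.\<close>

lemma isometry_midpoint:
  fixes a b :: "'a::real_normed_vector"
  assumes "isometry f"
  shows "f (midpoint a b) = midpoint (f a) (f b)"
proof -
  have bij: "bij f" using assms by (simp add: isometry_def)
  define h where "h = (\<lambda>x. (a + b) - x) \<circ> (inv f \<circ> ((\<lambda>x. (f a + f b) - x) \<circ> f))"
  have "isometry h" unfolding h_def
    by (intro isometry_compose isometry_reflection isometry_inv assms)
  moreover have "h a = a" "h b = b" using bij by (auto simp: h_def bij_is_inj)
  ultimately have "h (midpoint a b) = midpoint a b" by (rule isometry_fixing_two_points_fixes_midpoint)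
  then have "inv f (f a + f b - f (midpoint a b)) = (a + b) - midpoint a b"
    by (simp add: h_def algebra_simps)
  also have "\<dots> = midpoint a b" by (metis add_diff_cancel midpoint_plus_self)
  finally have "f a + f b - f (midpoint a b) = f (midpoint a b)"
    using bij by (metis bij_inv_eq_iff)
  then have "f a + f b = 2 *\<^sub>R f (midpoint a b)" by (simp add: scaleR_2 algebra_simps)
  then show ?thesis by (simp add: midpoint_def)
qed

text \<open>Preserved midpoints and \<open>T 0 = 0\<close> give additivity, and preserved norms then
  give real homogeneity. The base point \<open>a\<close> is free so that it can be the position of
  the pinned vertex.\<close>

lemma isometry_affine:
  fixes g :: "'a::real_normed_vector \<Rightarrow> 'a"
  assumes "isometry g"
  obtains T where "T \<in> linear_isometries" "\<And>x. g x = T (x - a) + g a"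
proof -
  define T where "T x = g (x + a) - g a" for x
  have dist_T: "dist (T x) (T y) = dist x y" for x y
    using assms by (simp add: T_def isometry_def dist_norm)
  have T0: "T 0 = 0" by (simp add: T_def)
  have norm_T: "norm (T x) = norm x" for x using dist_T[of x 0] T0 by simp
  have mid: "T (midpoint x y) = midpoint (T x) (T y)" for x y
  proof -
    have "midpoint x y + a = midpoint (x + a) (y + a)"
    proof -
      have "x + a + (y + a) = (x + y) + 2 *\<^sub>R a" by (simp add: scaleR_2)
      then show ?thesis unfolding midpoint_def by (simp only: scaleR_add_right[of _ "x + y"]) simp
    qed
    then have "T (midpoint x y) = midpoint (g (x + a)) (g (y + a)) - g a"
      using isometry_midpoint[OF assms] by (simp add: T_def)
    also have "\<dots> = midpoint (T x) (T y)"
    proof -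
      have "T x + T y = (g (x + a) + g (y + a)) - 2 *\<^sub>R g a" by (simp add: T_def scaleR_2)
      then show ?thesis unfolding midpoint_def by (simp only: scaleR_diff_right) simp
    qed
    finally show ?thesis .
  qed
  have half: "T (x /\<^sub>R 2) = T x /\<^sub>R 2" for x using mid[of x 0] by (simp add: T0 midpoint_def)
  have add: "T (x + y) = T x + T y" for x y
  proof -
    have "T (x + y) /\<^sub>R 2 = (T x + T y) /\<^sub>R 2"
      using mid[of x y] half[of "x + y"] by (simp add: midpoint_def)
    then show ?thesis by simp
  qed
  have nat: "T (real n *\<^sub>R x) = real n *\<^sub>R T x" for n x
    by (induction n) (simp_all add: T0 add scaleR_left_distrib)
  have neg: "T (- x) = - T x" for x
    using add[of x "-x"] T0 by (simp add: eq_neg_iff_add_eq_0 add.commute)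
  have int: "T (of_int n *\<^sub>R x) = of_int n *\<^sub>R T x" for n x
  proof (cases n rule: int_cases2)
    case (nonneg m) then show ?thesis using nat by simp
  next
    case (nonpos m) then show ?thesis using nat[of m x] neg[of "real m *\<^sub>R x"] by simp
  qed
  have scale: "T (r *\<^sub>R x) = r *\<^sub>R T x" for r x
  proof -
    \<comment> \<open>\<open>h\<close> is additive with period 1 and bounded on the unit interval, hence bounded, hence 0.\<close>
    define h where "h s = T (s *\<^sub>R x) - s *\<^sub>R T x" for s
    have h_add: "h (s + t) = h s + h t" for s t by (simp add: h_def add scaleR_left_distrib)
    have h_int: "h (of_int n) = 0" for n by (simp add: h_def int)
    have h_bound: "norm (h s) \<le> 2 * norm x" for s
    proof -
      have "h s = h (frac s)" using h_add[of "frac s" "of_int \<lfloor>s\<rfloor>"] h_int by (simp add: frac_def)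
      also have "norm \<dots> \<le> norm (T (frac s *\<^sub>R x)) + norm (frac s *\<^sub>R T x)"
        unfolding h_def by (rule norm_triangle_ineq4)
      also have "\<dots> = 2 * (frac s * norm x)" by (simp add: norm_T)
      also have "\<dots> \<le> 2 * (1 * norm x)"
        using frac_lt_1[of s] by (intro mult_left_mono mult_right_mono) auto
      finally show ?thesis by simp
    qed
    have h_nat: "h (real n * r) = real n *\<^sub>R h r" for n
      by (induction n) (use h_int[of 0] in \<open>auto simp: h_add scaleR_left_distrib distrib_right\<close>)
    have "norm (h r) = 0"
    proof (rule ccontr)
      assume "norm (h r) \<noteq> 0"
      then have pos: "0 < norm (h r)" by simp
      obtain n where "2 * norm x / norm (h r) < real n" using reals_Archimedean2 by blast
      then have "2 * norm x < real n * norm (h r)" using pos by (simp add: divide_less_eq)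
      also have "\<dots> = norm (h (real n * r))" by (simp add: h_nat)
      finally show False using h_bound[of "real n * r"] by simp
    qed
    then show ?thesis by (simp add: h_def)
  qed
  have "linear T" by (intro linearI add scale)
  moreover have "bij T"
  proof -
    have "bij g" using assms by (simp add: isometry_def)
    moreover have "T = (\<lambda>x. x - g a) \<circ> (g \<circ> (\<lambda>x. x + a))" by (auto simp: T_def)
    moreover have "bij (\<lambda>x. x - g a)" by (rule o_bij[of "\<lambda>x. x + g a"]) auto
    moreover have "bij (\<lambda>x. x + a)" by (rule o_bij[of "\<lambda>x. x - a"]) auto
    ultimately show ?thesis by (metis bij_comp)
  qed
  ultimately have "T \<in> linear_isometries" using dist_T by (simp add: linear_isometries_def isometry_def)
  then show ?thesis using that[of T] by (simp add: T_def)
qed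

lemma linear_isometry_norm: "T \<in> linear_isometries \<Longrightarrow> norm (T x) = norm x"
proof -
  assume T: "T \<in> linear_isometries"
  then have "dist (T x) (T 0) = dist x 0" by (simp only: linear_isometries_def isometry_def) simp
  moreover have "T 0 = 0" using T by (simp add: linear_isometries_def linear_0)
  ultimately show ?thesis by simp
qed

section \<open>Euclidean coordinates on a finite-dimensional space\<close>

lemma finite_basis_coordinates:
  fixes B :: "'a::real_vector set"
  assumes "finite B" "independent B" "span B = UNIV" and e: "bij_betw e (UNIV::'b::finite set) B"
  shows "bij (\<lambda>y::real^'b. \<Sum>i\<in>UNIV. y $ i *\<^sub>R e i)"
proof (rule bijI)
  have sum_e: "(\<Sum>i\<in>UNIV. u (e i) *\<^sub>R e i) = (\<Sum>v\<in>B. u v *\<^sub>R v)" for u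
    using sum.reindex_bij_betw[OF e, of "\<lambda>v. u v *\<^sub>R v"] .
  have inv: "inv e (e i) = i" for i using e by (simp add: bij_betw_def)
  show "inj (\<lambda>y::real^'b. \<Sum>i\<in>UNIV. y $ i *\<^sub>R e i)"
  proof (rule injI)
    fix x y :: "real^'b"
    assume "(\<Sum>i\<in>UNIV. x $ i *\<^sub>R e i) = (\<Sum>i\<in>UNIV. y $ i *\<^sub>R e i)"
    then have "(\<Sum>i\<in>UNIV. (x - y) $ (inv e (e i)) *\<^sub>R e i) = 0"
      by (simp add: inv scaleR_diff_left sum_subtractf)
    then have "(\<Sum>v\<in>B. (x - y) $ inv e v *\<^sub>R v) = 0"
      using sum_e[of "\<lambda>v. (x - y) $ inv e v"] by simp
    then have "\<forall>v\<in>B. (x - y) $ inv e v = 0"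
      using independentD[OF assms(2,1) order_refl, of "\<lambda>v. (x - y) $ inv e v"] by blast
    then have "(x - y) $ i = 0" for i using e inv by (metis bij_betw_apply iso_tuple_UNIV_I)
    then show "x = y" by (simp add: vec_eq_iff)
  qed
  show "surj (\<lambda>y::real^'b. \<Sum>i\<in>UNIV. y $ i *\<^sub>R e i)"
    unfolding surj_def
  proof
    fix x
    have "x \<in> span B" using assms(3) by simp
    then obtain u where "x = (\<Sum>v\<in>B. u v *\<^sub>R v)" using span_finite[OF assms(1)] by auto
    then have "x = (\<Sum>i\<in>UNIV. (\<chi> i. u (e i)) $ i *\<^sub>R e i)" using sum_e[of u] by simp
    then show "\<exists>y::real^'b. x = (\<Sum>i\<in>UNIV. y $ i *\<^sub>R e i)" by blast
  qed
qed

text \<open>The index type must be inhabited and finite for every space; \<open>{0}\<close> is a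
  dummy for spaces without a nonempty finite basis.\<close>

definition chosen_basis :: "'a::real_vector set" where
  "chosen_basis = (if \<exists>B::'a set. finite B \<and> independent B \<and> span B = UNIV \<and> B \<noteq> {}
     then SOME B. finite B \<and> independent B \<and> span B = UNIV \<and> B \<noteq> {} else {0})"

lemma chosen_basis: "finite (chosen_basis :: 'a::real_vector set)" "(chosen_basis :: 'a set) \<noteq> {}"
proof -
  have "finite (chosen_basis :: 'a set) \<and> (chosen_basis :: 'a set) \<noteq> {}"
  proof (cases "\<exists>B::'a set. finite B \<and> independent B \<and> span B = UNIV \<and> B \<noteq> {}")
    case True
    from someI_ex[OF this] show ?thesis using True by (simp add: chosen_basis_def)
  next
    case False
    then have "chosen_basis = {0::'a}" by (simp only: chosen_basis_def if_False)
    then show ?thesis by (metis finite.emptyI finite_insert insert_not_empty)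
  qed
  then show "finite (chosen_basis :: 'a set)" "(chosen_basis :: 'a set) \<noteq> {}" by auto
qed

text \<open>The dimension of \<^typ>\<open>'a\<close> is only known as a number; indexing coordinates by a basis provides
  a Euclidean space of that dimension as a type.\<close>

typedef (overloaded) ('a::real_vector) basis_index = "chosen_basis :: 'a set"
  using chosen_basis(2) by blast

instance basis_index :: (real_vector) finite
proof
  have "finite (Rep_basis_index ` (UNIV :: 'a basis_index set))"
    using Rep_basis_index by (intro finite_subset[OF _ chosen_basis(1)]) blast
  then show "finite (UNIV :: 'a basis_index set)"
    by (rule finite_imageD) (simp add: Rep_basis_index_inject inj_on_def)
qed

text \<open>A nonzero vector excludes the empty basis, so \<open>chosen_basis\<close> is a genuine
  basis and not its default value.\<close>

lemma basis_coordinates_exist: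
  fixes x :: "'a::real_vector"
  assumes "has_dimension TYPE('a) d" and "x \<noteq> 0"
  obtains L :: "real^('a basis_index) \<Rightarrow> 'a" where "linear L" "bij L"
proof -
  let ?P = "\<lambda>B::'a set. finite B \<and> independent B \<and> span B = UNIV \<and> B \<noteq> {}"
  obtain B :: "'a set" where B: "finite B" "independent B" "span B = UNIV"
    using assms(1) unfolding has_dimension_def by blast
  then have "B \<noteq> {}" using assms(2) by (metis UNIV_I singletonD span_empty)
  then have "\<exists>B. ?P B" using B by blast
  from someI_ex[OF this] this have P: "?P chosen_basis" by (simp add: chosen_basis_def)
  have e: "bij_betw Rep_basis_index (UNIV :: 'a basis_index set) chosen_basis"
    using Rep_basis_index by (intro bij_betwI[where g = Abs_basis_index])
      (auto simp: Rep_basis_index_inverse Abs_basis_index_inverse)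
  have "linear (\<lambda>y::real^('a basis_index). \<Sum>i\<in>UNIV. y $ i *\<^sub>R Rep_basis_index i)"
    by (auto intro!: linearI simp: scaleR_left_distrib sum.distrib scaleR_sum_right)
  then show ?thesis using that finite_basis_coordinates[OF _ _ _ e] P by blast
qed

text \<open>\<open>B\<close> is the minimum of \<open>norm (L y)\<close> on the Euclidean unit
  sphere. It turns bounds in the given norm into Euclidean ones.\<close>

lemma linear_inj_bounded_below:
  fixes L :: "'e::euclidean_space \<Rightarrow> 'a::real_normed_vector"
  assumes "linear L" "inj L"
  obtains B where "0 < B" "\<And>y. B * norm y \<le> norm (L y)"
proof -
  let ?S = "sphere (0::'e) 1"
  have cont: "continuous_on UNIV L"
    using assms(1) by (simp add: linear_continuous_on linear_conv_bounded_linear)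
  have "?S \<noteq> {}" by simp
  then obtain y0 where y0: "y0 \<in> ?S" "\<And>y. y \<in> ?S \<Longrightarrow> norm (L y0) \<le> norm (L y)"
    using continuous_attains_inf[of ?S "\<lambda>y. norm (L y)"] continuous_on_subset[OF cont]
    by (metis compact_sphere continuous_on_norm subset_UNIV)
  have "y0 \<noteq> 0" using y0(1) by auto
  then have "0 < norm (L y0)"
    using assms by (metis linear_injective_0 zero_less_norm_iff)
  moreover have "norm (L y0) * norm y \<le> norm (L y)" for y
  proof (cases "y = 0")
    case False
    then have "norm (L y0) \<le> norm (L (y /\<^sub>R norm y))" by (intro y0(2)) simp
    also have "\<dots> = norm (L y) / norm y"
      by (simp add: linear_cmul[OF assms(1)] divide_inverse mult.commute)
    finally show ?thesis using False by (simp add: pos_le_divide_eq)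
  qed simp
  ultimately show ?thesis by (rule that)
qed

section \<open>Support functionals of a smooth norm\<close>

lemma the_support_functional:
  assumes "smooth_space TYPE('a::real_normed_vector)"
  shows "support_functional x f \<longleftrightarrow> f = the_support_functional (x::'a)"
proof -
  have "\<exists>!f. support_functional x f"
  \<comment> \<open>Smoothness speaks of nonzero points only; at 0 the zero functional is the only
    one of norm 0.\<close>
  proof (cases "x = 0")
    case True
    then show ?thesis by (intro ex1I[of _ 0]) (auto simp: support_functional_def)
  next
    case False
    then show ?thesis using assms by (simp add: smooth_space_def smooth_point_def)
  qed
  then show ?thesis unfolding the_support_functional_def by (metis theI')
qed

text \<open>Since \<open>T\<close> is isometric and fixes \<open>x\<close>, the support functional
  composed with \<open>T\<close> is again a support functional of \<open>x\<close>; by uniqueness it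
  is unchanged.\<close>

lemma support_functional_fixed_by_isometry:
  assumes smooth: "smooth_space TYPE('a::real_normed_vector)"
    and T: "T \<in> linear_isometries" and x: "T x = (x::'a)"
  shows "blinfun_apply (the_support_functional x) (w - T w) = 0"
proof -
  let ?f = "the_support_functional x"
  have f: "support_functional x ?f" using the_support_functional[OF smooth] by blast
  have bT: "bounded_linear T"
    using T linear_isometry_norm[OF T] by (intro bounded_linear_intro[where K = 1])
      (auto simp: linear_isometries_def linear_add linear_cmul)
  have apply_fT: "blinfun_apply (?f o\<^sub>L Blinfun T) y = blinfun_apply ?f (T y)" for y
    by (simp add: bounded_linear_Blinfun_apply[OF bT])
  have "norm (?f o\<^sub>L Blinfun T) \<le> norm x"
  proof (rule norm_blinfun_bound)
    show "norm (blinfun_apply (?f o\<^sub>L Blinfun T) y) \<le> norm x * norm y" for y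
      unfolding apply_fT
      using norm_blinfun[of ?f "T y"] f by (simp add: linear_isometry_norm[OF T] support_functional_def)
  qed simp
  moreover have "norm x * norm x \<le> norm (?f o\<^sub>L Blinfun T) * norm x"
    using norm_blinfun[of "?f o\<^sub>L Blinfun T" x] f
    by (simp only: apply_fT x) (simp add: support_functional_def power2_eq_square)
  ultimately have "norm (?f o\<^sub>L Blinfun T) = norm x"
    by (cases "x = 0") (auto simp: antisym)
  then have "support_functional x (?f o\<^sub>L Blinfun T)"
    using f unfolding support_functional_def apply_fT x by simp
  then have "?f o\<^sub>L Blinfun T = ?f" using the_support_functional[OF smooth] by blast
  then show ?thesis using apply_fT[of w] by (simp add: blinfun.diff_right)
qed

text \<open>The support functionals are the subgradients of half the squared norm; as they are unique and
  bounded, they depend continuously on the point, which makes the function continuously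
  differentiable.\<close>

lemma half_norm_squared_C1:
  fixes L :: "'e::euclidean_space \<Rightarrow> 'a::real_normed_vector"
  assumes smooth: "smooth_space TYPE('a)" and L: "linear L" "bij L"
  defines "D \<equiv> \<lambda>y. \<Sum>i\<in>Basis. blinfun_apply (the_support_functional (L y)) (L i) *\<^sub>R i"
  shows "continuous_on UNIV D"
    and "D y \<bullet> h = blinfun_apply (the_support_functional (L y)) (L h)"
    and "((\<lambda>y. 1/2 * (norm (L y))\<^sup>2) has_derivative (\<lambda>h. D y \<bullet> h)) (at y)"
proof -
  let ?\<phi> = "\<lambda>y. the_support_functional (L y)"
  have bL: "bounded_linear L" using L(1) by (simp add: linear_conv_bounded_linear)
  obtain M where M: "0 < M" "\<And>y. norm (L y) \<le> norm y * M"
    using bounded_linear.pos_bounded[OF bL] by blast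
  have contL: "continuous_on UNIV L" using bL by (simp add: linear_continuous_on)
  have \<phi>: "support_functional (L y) (?\<phi> y)" for y using the_support_functional[OF smooth] by blast
  have \<phi>_self: "blinfun_apply (?\<phi> y) (L y) = (norm (L y))\<^sup>2" for y using \<phi> by (simp add: support_functional_def)
  have \<phi>_bound: "\<bar>blinfun_apply (?\<phi> y) x\<bar> \<le> norm (L y) * norm x" for y x
    using norm_blinfun[of "?\<phi> y" x] \<phi>[of y] by (simp add: support_functional_def)
  have D_inner: "D y \<bullet> h = blinfun_apply (?\<phi> y) (L h)" for y h
  proof -
    have "blinfun_apply (?\<phi> y) (L h) = blinfun_apply (?\<phi> y) (L (\<Sum>i\<in>Basis. (h \<bullet> i) *\<^sub>R i))"
      by (simp add: euclidean_representation)
    also have "\<dots> = (\<Sum>i\<in>Basis. (h \<bullet> i) * blinfun_apply (?\<phi> y) (L i))"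
      by (simp add: linear_sum[OF L(1)] linear_cmul[OF L(1)] blinfun.sum_right blinfun.scaleR_right)
    also have "\<dots> = D y \<bullet> h" unfolding D_def by (simp add: inner_sum_left inner_commute[of h] mult.commute)
    finally show ?thesis by simp
  qed
  show "D y \<bullet> h = blinfun_apply (the_support_functional (L y)) (L h)" by (rule D_inner)
  have D_bound: "norm (D y) \<le> norm (L y) * M" for y
  proof (cases "D y = 0")
    case False
    have "norm (D y) * norm (D y) = D y \<bullet> D y" by (simp add: dot_square_norm power2_eq_square)
    also have "\<dots> \<le> norm (L y) * norm (L (D y))" using \<phi>_bound[of y "L (D y)"] by (simp add: D_inner)
    also have "\<dots> \<le> norm (L y) * (norm (D y) * M)" by (intro mult_left_mono M) auto
    finally have "norm (D y) * norm (D y) \<le> (norm (L y) * M) * norm (D y)" by (simp add: algebra_simps)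
    then show ?thesis using False by simp
  qed (use M(1) in simp)
  \<comment> \<open>Closed graph argument: on a ball \<open>D\<close> takes values in a compact set,
    so it suffices that a limit of support functionals is a support functional of the limit point,
    where uniqueness identifies it.\<close>
  have cont_cball: "continuous_on (cball 0 R) D" for R
  proof (rule continuous_from_closed_graph)
    show "compact (cball (0::'e) (\<bar>R\<bar> * M * M))" by simp
    show "D \<in> cball 0 R \<rightarrow> cball 0 (\<bar>R\<bar> * M * M)"
    proof
      fix y :: 'e assume "y \<in> cball 0 R"
      then have "norm y \<le> \<bar>R\<bar>" by simp
      then have "norm (L y) * M \<le> (\<bar>R\<bar> * M) * M"
        using M by (intro mult_right_mono order_trans[OF M(2)]) auto
      then show "D y \<in> cball 0 (\<bar>R\<bar> * M * M)" using D_bound[of y] by simp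
    qed
    show "closed ((\<lambda>y. (y, D y)) ` cball 0 R)"
      unfolding closed_sequential_limits
    proof (intro allI impI, elim conjE)
      fix X l assume X: "\<forall>n. X n \<in> (\<lambda>y. (y, D y)) ` cball 0 R" and lim: "X \<longlonglongrightarrow> l"
      obtain y s where l: "l = (y, s)" by (cases l)
      define z where "z n = fst (X n)" for n
      have z: "z n \<in> cball 0 R" "X n = (z n, D (z n))" for n
        using X[rule_format, of n] by (auto simp: z_def)
      have zy: "z \<longlonglongrightarrow> y" using tendsto_fst[OF lim] by (simp add: z_def[abs_def] l)
      have Ds: "(\<lambda>n. D (z n)) \<longlonglongrightarrow> s" using tendsto_snd[OF lim] by (simp add: z(2) l)
      have yR: "y \<in> cball 0 R" using closed_sequentially[OF closed_cball _ zy] z(1) by blast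
      have Lz: "(\<lambda>n. L (z n)) \<longlonglongrightarrow> L y"
        using continuous_on_tendsto_compose[OF contL zy] by simp
      define \<psi> where "\<psi> x = s \<bullet> inv L x" for x
      have L_inv: "L (inv L x) = x" for x using L(2) by (simp add: bij_is_surj surj_f_inv_f)
      have inv_L: "inv L (L x) = x" for x using L(2) by (simp add: bij_is_inj)
      have "linear (inv L)" using L_inv inv_L linear_add[OF L(1)] linear_cmul[OF L(1)] by (intro linearI) metis+
      have \<psi>_bound: "norm (\<psi> x) \<le> norm (L y) * norm x" for x
      proof (rule LIMSEQ_le)
        show "(\<lambda>n. norm (D (z n) \<bullet> inv L x)) \<longlonglongrightarrow> norm (\<psi> x)"
          unfolding \<psi>_def by (intro tendsto_intros Ds)
        show "(\<lambda>n. norm (L (z n)) * norm x) \<longlonglongrightarrow> norm (L y) * norm x"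
          by (intro tendsto_intros Lz)
        show "\<exists>N. \<forall>n\<ge>N. norm (D (z n) \<bullet> inv L x) \<le> norm (L (z n)) * norm x"
          using \<phi>_bound by (simp add: D_inner L_inv)
      qed
      have b\<psi>: "bounded_linear \<psi>"
        using \<psi>_bound linear_add[OF \<open>linear (inv L)\<close>] linear_cmul[OF \<open>linear (inv L)\<close>]
        by (intro bounded_linear_intro[where K = "norm (L y)"])
          (auto simp: \<psi>_def inner_add_right mult.commute)
      have "(\<lambda>n. D (z n) \<bullet> z n) \<longlonglongrightarrow> s \<bullet> y" by (intro tendsto_intros Ds zy)
      moreover have "(\<lambda>n. D (z n) \<bullet> z n) \<longlonglongrightarrow> (norm (L y))\<^sup>2"
        unfolding D_inner \<phi>_self by (intro tendsto_intros Lz)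
      ultimately have \<psi>_self: "\<psi> (L y) = (norm (L y))\<^sup>2"
        using LIMSEQ_unique by (simp add: \<psi>_def inv_L)
      have "norm (Blinfun \<psi>) \<le> norm (L y)"
        using \<psi>_bound by (intro norm_blinfun_bound) (auto simp: bounded_linear_Blinfun_apply[OF b\<psi>])
      moreover have "norm (L y) * norm (L y) \<le> norm (Blinfun \<psi>) * norm (L y)"
        using norm_blinfun[of "Blinfun \<psi>" "L y"] \<psi>_self
        by (simp add: bounded_linear_Blinfun_apply[OF b\<psi>] power2_eq_square)
      ultimately have "norm (Blinfun \<psi>) = norm (L y)"
        by (cases "L y = 0") (auto simp: antisym)
      then have "support_functional (L y) (Blinfun \<psi>)"
        using \<psi>_self by (simp add: support_functional_def bounded_linear_Blinfun_apply[OF b\<psi>])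
      then have "Blinfun \<psi> = ?\<phi> y" using the_support_functional[OF smooth] by blast
      then have "s \<bullet> h = D y \<bullet> h" for h
        unfolding D_inner by (metis \<psi>_def b\<psi> bounded_linear_Blinfun_apply inv_L)
      then have "s = D y" by (metis vector_eq_rdot)
      then show "l \<in> (\<lambda>y. (y, D y)) ` cball 0 R" using yR l by blast
    qed
  qed
  have contD: "isCont D y" for y
  proof -
    have "y \<in> interior (cball 0 (norm y + 1))" by simp
    then show ?thesis using cont_cball continuous_on_interior by blast
  qed
  then show "continuous_on UNIV D" by (simp add: continuous_at_imp_continuous_on)
  let ?N = "\<lambda>y. 1/2 * (norm (L y))\<^sup>2"
  have subgrad: "D y \<bullet> (x - y) \<le> ?N x - ?N y" for x y
  proof -
    have "D y \<bullet> (x - y) = blinfun_apply (?\<phi> y) (L x) - (norm (L y))\<^sup>2"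
      using D_inner[of y y] by (simp add: inner_diff_right D_inner \<phi>_self)
    also have "\<dots> \<le> norm (L y) * norm (L x) - (norm (L y))\<^sup>2"
      using \<phi>_bound[of y "L x"] by simp
    also have "\<dots> \<le> ?N x - ?N y"
      using sum_squares_bound[of "norm (L y)" "norm (L x)"] by simp
    finally show ?thesis .
  qed
  show "(?N has_derivative (\<lambda>h. D y \<bullet> h)) (at y)"
    unfolding has_derivative_at_alt
  proof (intro conjI allI impI)
    show "bounded_linear (\<lambda>h. D y \<bullet> h)" by (rule bounded_linear_inner_right)
    fix e :: real assume "0 < e"
    then obtain d where d: "0 < d" "\<And>x. dist x y < d \<Longrightarrow> dist (D x) (D y) < e"
      using contD[of y] unfolding continuous_at_eps_delta by blast
    \<comment> \<open>The subgradient inequalities at \<open>y\<close> and at \<open>x\<close> place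
      the error between 0 and \<open>(D x - D y) \<bullet> (x - y)\<close>, which continuity of
      \<open>D\<close> makes small.\<close>
    show "\<exists>d>0. \<forall>x. norm (x - y) < d \<longrightarrow> norm (?N x - ?N y - D y \<bullet> (x - y)) \<le> e * norm (x - y)"
    proof (intro exI[of _ d] conjI allI impI d(1))
      fix x assume "norm (x - y) < d"
      then have e: "norm (D x - D y) < e" using d(2)[of x] by (simp add: dist_norm)
      have "?N x - ?N y - D y \<bullet> (x - y) \<le> - (D x \<bullet> (y - x)) - D y \<bullet> (x - y)"
        using subgrad[of x y] by simp
      also have "\<dots> = (D x - D y) \<bullet> (x - y)" by (simp add: algebra_simps)
      also have "\<dots> \<le> norm (D x - D y) * norm (x - y)" by (rule norm_cauchy_schwarz)
      also have "\<dots> \<le> e * norm (x - y)" using e by (intro mult_right_mono) auto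
      finally show "norm (?N x - ?N y - D y \<bullet> (x - y)) \<le> e * norm (x - y)"
        using subgrad[of y x] by (simp add: abs_le_iff)
    qed
  qed
qed

section \<open>Frameworks with a pinned vertex\<close>

lemma has_derivative_vec:
  fixes f :: "'e::real_normed_vector \<Rightarrow> real^'n"
  assumes "\<And>i. ((\<lambda>x. f x $ i) has_derivative (\<lambda>h. f' h $ i)) (at x within S)"
  shows "(f has_derivative f') (at x within S)"
proof (subst has_derivative_componentwise_within, intro ballI)
  fix b :: "real^'n" assume "b \<in> Basis"
  then obtain i where "b = axis i 1" by (auto simp: Basis_vec_def)
  then show "((\<lambda>x. f x \<bullet> b) has_derivative (\<lambda>h. f' h \<bullet> b)) (at x within S)"
    using assms[of i] by (simp add: inner_axis)
qed

lemma measurement_eq_iff: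
  fixes p q :: "('a::real_normed_vector)^('v::finite)"
  assumes "simple_graph E"
  shows "measurement E p = measurement E q \<longleftrightarrow>
    (\<forall>v w. {v, w} \<in> E \<longrightarrow> norm (p $ v - p $ w) = norm (q $ v - q $ w))"
proof (intro iffI allI impI)
  fix v w assume "measurement E p = measurement E q" "{v, w} \<in> E"
  then have "1/2 * (norm (p $ v - p $ w))\<^sup>2 = 1/2 * (norm (q $ v - q $ w))\<^sup>2"
    using measurement_nth[of v w E p] measurement_nth[of v w E q] by simp
  then show "norm (p $ v - p $ w) = norm (q $ v - q $ w)" by simp
next
  assume eq: "\<forall>v w. {v, w} \<in> E \<longrightarrow> norm (p $ v - p $ w) = norm (q $ v - q $ w)"
  show "measurement E p = measurement E q"
  proof (subst vec_eq_iff, intro allI)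
    fix e
    show "measurement E p $ e = measurement E q $ e"
    proof (cases "e \<in> E")
      case True
      then obtain v w where "e = {v, w}"
        using assms by (metis card_2_iff simple_graph_def)
      then show ?thesis using True eq by (simp add: measurement_nth)
    qed (simp add: measurement_def)
  qed
qed

lemma linear_edge_diff: "linear (\<lambda>y::('a::real_normed_vector)^('v::finite). edge_diff y e)"
  by (rule linearI) (simp_all add: edge_diff_def algebra_simps)

lemma strongly_regular_rank:
  fixes p q r :: "('a::real_normed_vector)^('v::finite)"
  assumes "strongly_regular E p" "equivalent_frameworks E p q"
  shows "well_positioned E q" "rigidity_rank E q = rigidity_rank E p"
    "well_positioned E r \<Longrightarrow> rigidity_rank E r \<le> rigidity_rank E q"
proof -
  let ?R = "{rigidity_rank E r | r::'a^'v. well_positioned E r}"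
  \<comment> \<open>\<open>Max\<close> is meaningful only on a finite set, so the ranks are bounded
    by the dimension of the target.\<close>
  have "rigidity_rank E r \<le> DIM(real^('v set))" for r :: "'a^'v"
    unfolding rigidity_rank_def by (rule dim_subset_UNIV)
  then have "?R \<subseteq> {..DIM(real^('v set))}" by blast
  then have fin: "finite ?R" using finite_subset by blast
  have "equivalent_frameworks E p p" by (simp add: equivalent_frameworks_def)
  then have "rigidity_rank E p = Max ?R" using assms(1) by (simp add: strongly_regular_def)
  moreover have q: "well_positioned E q" "rigidity_rank E q = Max ?R"
    using assms by (auto simp: strongly_regular_def)
  ultimately show "well_positioned E q" "rigidity_rank E q = rigidity_rank E p" by auto
  show "rigidity_rank E r \<le> rigidity_rank E q" if "well_positioned E r"
    unfolding q(2) by (intro Max_ge fin) (use that in blast)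
qed

text \<open>The parallelogram law holds on every line, so a pair violating it is linearly
  independent.\<close>

lemma non_Euclidean_independent_vectors:
  assumes "non_Euclidean TYPE('a::real_normed_vector)"
  obtains x y :: "'a::real_normed_vector" where "x \<noteq> 0" "\<And>t. y \<noteq> t *\<^sub>R x"
proof -
  obtain x y :: 'a where xy: "(norm (x + y))\<^sup>2 + (norm (x - y))\<^sup>2 \<noteq> 2 * (norm x)\<^sup>2 + 2 * (norm y)\<^sup>2"
    using assms unfolding non_Euclidean_def by blast
  have "x \<noteq> 0" using xy by auto
  moreover have "y \<noteq> t *\<^sub>R x" for t
  proof
    assume y: "y = t *\<^sub>R x"
    have "x + y = (1 + t) *\<^sub>R x" "x - y = (1 - t) *\<^sub>R x" by (simp_all add: y algebra_simps)
    then have "(norm (x + y))\<^sup>2 + (norm (x - y))\<^sup>2 = (1 + t)\<^sup>2 * (norm x)\<^sup>2 + (1 - t)\<^sup>2 * (norm x)\<^sup>2"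
      by (simp add: power_mult_distrib)
    also have "\<dots> = 2 * (norm x)\<^sup>2 + 2 * (norm y)\<^sup>2"
      by (simp add: y power_mult_distrib power2_eq_square algebra_simps)
    finally show False using xy by simp
  qed
  ultimately show ?thesis by (rule that)
qed

text \<open>The line through \<open>y\<close> in direction \<open>x\<close> misses the origin, and
  its radial projection to the sphere is injective.\<close>

lemma infinite_sphere:
  fixes x y :: "'a::real_normed_vector"
  assumes "x \<noteq> 0" and y: "\<And>t. y \<noteq> t *\<^sub>R x" and "0 < \<rho>"
  shows "infinite {z::'a. norm z = \<rho>}"
proof -
  define c where "c t = \<rho> / norm (y + t *\<^sub>R x)" for t
  have ne: "y + t *\<^sub>R x \<noteq> 0" for t using y[of "-t"] by (simp add: eq_neg_iff_add_eq_0)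
  have c: "0 < c t" for t using ne \<open>0 < \<rho>\<close> by (simp add: c_def)
  have "inj (\<lambda>t. c t *\<^sub>R (y + t *\<^sub>R x))"
  proof (rule injI)
    fix s t assume eq: "c s *\<^sub>R (y + s *\<^sub>R x) = c t *\<^sub>R (y + t *\<^sub>R x)"
    then have "(c s - c t) *\<^sub>R y = (c t * t - c s * s) *\<^sub>R x" by (simp add: algebra_simps)
    moreover have "y = ((c t * t - c s * s) / (c s - c t)) *\<^sub>R x"
      if "(c s - c t) *\<^sub>R y = (c t * t - c s * s) *\<^sub>R x" "c s - c t \<noteq> 0"
      using that by (metis divide_inverse_commute scaleR_scaleR scaleR_one left_inverse)
    ultimately have "c s = c t" using y by (metis right_minus_eq)
    then show "s = t" using eq c[of t] \<open>x \<noteq> 0\<close> by simp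
  qed
  then have "infinite (range (\<lambda>t. c t *\<^sub>R (y + t *\<^sub>R x)))" by (simp add: finite_image_iff infinite_UNIV_char_0)
  moreover have "range (\<lambda>t. c t *\<^sub>R (y + t *\<^sub>R x)) \<subseteq> {z. norm z = \<rho>}"
    using ne \<open>0 < \<rho>\<close> by (auto simp: c_def)
  ultimately show ?thesis using finite_subset by blast
qed

text \<open>Adjoints and the inverse function theorem are applied in a Euclidean space, so
  placements are handled through the linear bijection \<open>L\<close>. \<open>v0\<close> is the
  vertex to be pinned.\<close>

locale coordinates =
  fixes L :: "real^('b::finite) \<Rightarrow> 'a::real_normed_vector" and v0 :: "'v::finite"
  assumes smooth: "smooth_space TYPE('a)" and L: "linear L" "bij L"
begin

definition place :: "(real^'b)^'v \<Rightarrow> 'a^'v" where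
  "place y = (\<chi> v. L (y $ v))"

definition grad :: "real^'b \<Rightarrow> real^'b" where
  "grad y = (\<Sum>i\<in>Basis. blinfun_apply (the_support_functional (L y)) (L i) *\<^sub>R i)"

lemmas grad = half_norm_squared_C1[OF smooth L, folded grad_def]

text \<open>Recording the position of \<open>v0\<close> along with the edge lengths removes the translations.\<close>

definition pinned :: "'v set set \<Rightarrow> (real^'b)^'v \<Rightarrow> (real^('v set)) \<times> (real^'b)" where
  "pinned E y = (measurement E (place y), y $ v0)"

definition pinned' :: "'v set set \<Rightarrow> (real^'b)^'v \<Rightarrow> (((real^'b)^'v) \<Rightarrow>\<^sub>L ((real^('v set)) \<times> (real^'b)))" where
  "pinned' E y = Blinfun (\<lambda>x. (rigidity_operator E (place y) (place x), x $ v0))"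

text \<open>It does not refer to a graph, so the length of the deleted edge stays available over
  \<open>E - {e}\<close>.\<close>

definition edge_len :: "'v set \<Rightarrow> (real^'b)^'v \<Rightarrow> real" where
  "edge_len e y = 1/2 * (norm (L (edge_diff y e)))\<^sup>2"

definition edge_len' :: "'v set \<Rightarrow> (real^'b)^'v \<Rightarrow> (((real^'b)^'v) \<Rightarrow>\<^sub>L real)" where
  "edge_len' e y = Blinfun (\<lambda>x. grad (edge_diff y e) \<bullet> edge_diff x e)"

section \<open>Derivative and rank of the pinned measurement map\<close>

lemma L_inv: "L (inv L x) = x" and inv_L: "inv L (L y) = y"
  using L(2) by (simp_all add: bij_is_surj surj_f_inv_f bij_is_inj)

lemma L_eq_iff: "L x = L y \<longleftrightarrow> x = y"
  using L(2) by (simp add: bij_is_inj inj_eq)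

lemma place_nth: "place y $ v = L (y $ v)"
  by (simp add: place_def)

lemma place_surj: "\<exists>y. place y = q"
  by (intro exI[of _ "\<chi> v. inv L (q $ v)"]) (simp add: place_def vec_eq_iff L_inv)

lemma place_eq_iff: "place x = place y \<longleftrightarrow> x = y"
  by (simp add: vec_eq_iff place_nth L_eq_iff)

lemma edge_diff_place: "edge_diff (place y) e = L (edge_diff y e)"
  by (simp add: edge_diff_def place_nth linear_diff[OF L(1)])

lemma measurement_place: "measurement E (place y) = (\<chi> e. if e \<in> E then edge_len e y else 0)"
  by (auto simp: measurement_def edge_diff_place edge_len_def vec_eq_iff)

lemma bounded_linear_edge_diff: "bounded_linear (\<lambda>y::(real^'b)^'v. edge_diff y e)"
  by (rule linear_conv_bounded_linear[THEN iffD1, OF linear_edge_diff])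

lemma edge_len'_apply: "blinfun_apply (edge_len' e y) x = grad (edge_diff y e) \<bullet> edge_diff x e"
  unfolding edge_len'_def
  by (subst bounded_linear_Blinfun_apply)
    (simp_all add: bounded_linear_compose[OF bounded_linear_inner_right bounded_linear_edge_diff])

lemma rigidity_operator_place:
  "rigidity_operator E (place y) (place x) = (\<chi> e. if e \<in> E then blinfun_apply (edge_len' e y) x else 0)"
  by (auto simp: rigidity_operator_def edge_diff_place edge_len'_apply grad(2) vec_eq_iff)

lemma pinned'_apply:
  "blinfun_apply (pinned' E y) x = (rigidity_operator E (place y) (place x), x $ v0)"
proof -
  have "linear (\<lambda>x. (rigidity_operator E (place y) (place x), x $ v0))"
    by (rule linearI) (auto simp: rigidity_operator_place vec_eq_iff blinfun.add_right blinfun.scaleR_right)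
  then have "bounded_linear (\<lambda>x. (rigidity_operator E (place y) (place x), x $ v0))"
    by (simp add: linear_conv_bounded_linear)
  then show ?thesis unfolding pinned'_def by (simp add: bounded_linear_Blinfun_apply)
qed

lemma edge_len_has_derivative: "(edge_len e has_derivative blinfun_apply (edge_len' e y)) (at y)"
  unfolding edge_len_def edge_len'_apply[abs_def]
  by (rule has_derivative_compose[OF bounded_linear_imp_has_derivative[OF bounded_linear_edge_diff] grad(3)])

lemma continuous_edge_len'_apply: "continuous_on UNIV (\<lambda>y. blinfun_apply (edge_len' e y) x)"
  unfolding edge_len'_apply
  by (intro continuous_on_inner continuous_on_const continuous_on_compose2[OF grad(1)]
      linear_continuous_on bounded_linear_edge_diff) auto

lemma continuous_edge_len': "continuous_on UNIV (edge_len' e)"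
  by (intro continuous_on_blinfun_componentwise continuous_edge_len'_apply)

lemma pinned_has_derivative: "(pinned E has_derivative blinfun_apply (pinned' E y)) (at y)"
  unfolding pinned_def pinned'_apply[abs_def]
proof (rule has_derivative_Pair[OF has_derivative_vec bounded_linear_imp_has_derivative[OF bounded_linear_vec_nth]])
  fix e
  show "((\<lambda>y. measurement E (place y) $ e) has_derivative
      (\<lambda>h. rigidity_operator E (place y) (place h) $ e)) (at y)"
    by (cases "e \<in> E") (simp_all add: measurement_place rigidity_operator_place edge_len_has_derivative)
qed

lemma continuous_pinned': "continuous_on UNIV (pinned' E)"
proof (intro continuous_on_blinfun_componentwise)
  fix x :: "(real^'b)^'v"
  show "continuous_on UNIV (\<lambda>y. blinfun_apply (pinned' E y) x)"
    unfolding pinned'_apply rigidity_operator_place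
  proof (intro continuous_on_Pair continuous_on_vec_lambda continuous_on_const)
    show "continuous_on UNIV (\<lambda>y. if e \<in> E then blinfun_apply (edge_len' e y) x else 0)" for e
      by (cases "e \<in> E") (simp_all add: continuous_edge_len'_apply)
  qed
qed

lemma continuous_edge_len: "continuous_on UNIV (edge_len e)"
  by (intro continuous_at_imp_continuous_on ballI has_derivative_continuous[OF edge_len_has_derivative])

lemma continuous_pinned: "continuous_on UNIV (pinned E)"
  by (intro continuous_at_imp_continuous_on ballI has_derivative_continuous[OF pinned_has_derivative])

text \<open>Translations change no edge difference, so the position of \<open>v0\<close> can be
  prescribed independently of the edge components and the range is a product.\<close>

lemma rank_pinned': "dim (range (blinfun_apply (pinned' E y))) = rigidity_rank E (place y) + CARD('b)"
proof -
  let ?R = "\<lambda>x. rigidity_operator E (place y) (place x)"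
  have lin: "linear ?R"
    by (rule linearI) (auto simp: rigidity_operator_place vec_eq_iff blinfun.add_right blinfun.scaleR_right)
  have "range (blinfun_apply (pinned' E y)) = range ?R \<times> UNIV"
  proof
    show "range ?R \<times> UNIV \<subseteq> range (blinfun_apply (pinned' E y))"
    proof clarify
      fix x :: "(real^'b)^'v" and c :: "real^'b"
      define x' where "x' = x + (\<chi> v. c - x $ v0)"
      have "edge_diff x' e = edge_diff x e" for e by (simp add: x'_def edge_diff_def)
      then have "blinfun_apply (edge_len' e y) x' = blinfun_apply (edge_len' e y) x" for e
        by (simp add: edge_len'_apply)
      then have "?R x' = ?R x" by (simp only: rigidity_operator_place)
      moreover have "x' $ v0 = c" by (simp add: x'_def)
      ultimately have "(?R x, c) = blinfun_apply (pinned' E y) x'" by (simp add: pinned'_apply)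
      then show "(?R x, c) \<in> range (blinfun_apply (pinned' E y))" by blast
    qed
  qed (auto simp: pinned'_apply)
  moreover have "range ?R = range (rigidity_operator E (place y))"
  proof -
    have "range place = UNIV" using place_surj by (metis surj_def)
    then show ?thesis by (metis image_image)
  qed
  moreover have "subspace (range ?R)" using lin by (simp add: linear_subspace_image)
  ultimately show ?thesis by (simp add: dim_Times rigidity_rank_def)
qed

text \<open>In a smooth space the condition says that adjacent vertices are at distinct points.
  Openness makes a rank that is maximal among well-positioned placements locally maximal.\<close>

lemma open_well_positioned: "open {y. well_positioned E (place y)}"
proof -
  have "smooth_point (x - y) \<longleftrightarrow> x \<noteq> y" for x y :: 'a
    using smooth by (metis eq_iff_diff_eq_0 smooth_space_def smooth_point_def)
  then have "well_positioned E (place y) \<longleftrightarrow> (\<forall>vw\<in>{vw. {fst vw, snd vw} \<in> E}. y $ fst vw \<noteq> y $ snd vw)" for y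
    by (simp add: well_positioned_def place_nth L_eq_iff)
  then have "{y. well_positioned E (place y)} = (\<Inter>vw\<in>{vw. {fst vw, snd vw} \<in> E}. {y. y $ fst vw \<noteq> y $ snd vw})"
    by blast
  also have "open \<dots>"
    by (intro open_INT ballI open_Collect_neq linear_continuous_on bounded_linear_vec_nth) simp
  finally show ?thesis .
qed

text \<open>Turns strong regularity into what the fibre lemmas need: locally maximal rank at each
  point of the fibre and, by rank-nullity, constant kernel dimension along it.\<close>

lemma regular_rank:
  assumes "strongly_regular E (place y0)" "measurement E (place y) = measurement E (place y0)"
  obtains U where "open U" "y \<in> U"
    "\<And>z. z \<in> U \<Longrightarrow> dim (range (blinfun_apply (pinned' E z))) \<le> dim (range (blinfun_apply (pinned' E y)))"
    "dim {x. blinfun_apply (pinned' E y) x = 0} = dim {x. blinfun_apply (pinned' E y0) x = 0}"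
proof (rule that[OF open_well_positioned])
  have eq: "equivalent_frameworks E (place y0) (place y)"
    using assms(2) by (simp add: equivalent_frameworks_def)
  note s = strongly_regular_rank[OF assms(1) eq]
  show "y \<in> {y. well_positioned E (place y)}" using s(1) by simp
  show "dim (range (blinfun_apply (pinned' E z))) \<le> dim (range (blinfun_apply (pinned' E y)))"
    if "z \<in> {y. well_positioned E (place y)}" for z
    using s(3) that by (simp add: rank_pinned')
  have "dim (range (blinfun_apply (pinned' E z))) + dim {x. blinfun_apply (pinned' E z) x = 0} = dim (UNIV::((real^'b)^'v) set)" for z
    using dim_image_plus_kernel[OF _ subspace_UNIV, of "blinfun_apply (pinned' E z)"]
    by (simp add: blinfun.bounded_linear_right bounded_linear.linear)
  from this[of y] this[of y0]
  show "dim {x. blinfun_apply (pinned' E y) x = 0} = dim {x. blinfun_apply (pinned' E y0) x = 0}"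
    using s(2) by (simp add: rank_pinned')
qed

lemma pinned_insert:
  assumes "e \<in> E"
  shows "pinned E y = pinned E z \<longleftrightarrow> pinned (E - {e}) y = pinned (E - {e}) z \<and> edge_len e y = edge_len e z"
  using assms by (auto simp: pinned_def measurement_place vec_eq_iff)

lemma pinned'_insert:
  assumes "e \<in> E"
  shows "blinfun_apply (pinned' E y) x = 0 \<longleftrightarrow>
    blinfun_apply (pinned' (E - {e}) y) x = 0 \<and> blinfun_apply (edge_len' e y) x = 0"
  using assms by (auto simp: pinned'_apply rigidity_operator_place vec_eq_iff zero_prod_def)

text \<open>Linear isometries act on placements, conjugated by a translation so that they fix \<open>v0\<close>.\<close>

definition act :: "('a \<Rightarrow> 'a) \<Rightarrow> 'a \<Rightarrow> (real^'b)^'v \<Rightarrow> (real^'b)^'v" where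
  "act T a y = (\<chi> v. inv L (T (L (y $ v) - a) + a))"

lemma L_act: "L (act T a y $ v) = T (L (y $ v) - a) + a"
  by (simp add: act_def L_inv)

lemma edge_len_act:
  assumes "T \<in> linear_isometries"
  shows "edge_len e (act T a y) = edge_len e y"
proof -
  have lin: "linear T" using assms by (simp add: linear_isometries_def)
  have "L (edge_diff (act T a y) e) = T (L (edge_diff y e))"
    by (simp add: edge_diff_def linear_diff[OF L(1)] L_act linear_diff[OF lin])
  then show ?thesis by (simp add: edge_len_def linear_isometry_norm[OF assms])
qed

lemma pinned_act:
  assumes "T \<in> linear_isometries" "L (y $ v0) = a"
  shows "pinned E (act T a y) = pinned E y"
proof -
  have "L (act T a y $ v0) = L (y $ v0)"
    using assms by (simp add: L_act linear_isometries_def linear_0)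
  then show ?thesis
    using edge_len_act[OF assms(1)] by (auto simp: pinned_def measurement_place L_eq_iff vec_eq_iff)
qed

lemma continuous_act:
  assumes "T \<in> linear_isometries"
  shows "continuous_on UNIV (act T a)"
proof -
  have lin: "linear T" using assms by (simp add: linear_isometries_def)
  have lin': "linear (inv L \<circ> T \<circ> L)"
    by (rule linearI; simp add: linear_add[OF L(1)] linear_cmul[OF L(1)] linear_add[OF lin] linear_cmul[OF lin])
      (metis L_inv inv_L linear_add[OF L(1)] linear_cmul[OF L(1)])+
  then have cont: "continuous_on UNIV (inv L \<circ> T \<circ> L)"
    by (simp only: linear_continuous_on linear_conv_bounded_linear)
  have "act T a y = (\<chi> v. (inv L \<circ> T \<circ> L) (y $ v - inv L a) + inv L a)" for y
  proof (subst place_eq_iff[symmetric])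
    have "L ((inv L \<circ> T \<circ> L) (y $ v - inv L a) + inv L a) = T (L (y $ v) - a) + a" for v
      by (simp add: linear_add[OF L(1)] linear_diff[OF L(1)] L_inv)
    then show "place (act T a y) = place (\<chi> v. (inv L \<circ> T \<circ> L) (y $ v - inv L a) + inv L a)"
      by (simp add: vec_eq_iff place_nth L_act)
  qed
  then have "act T a = (\<lambda>y. \<chi> v. (inv L \<circ> T \<circ> L) (y $ v - inv L a) + inv L a)" by blast
  moreover have "continuous_on UNIV (\<lambda>y. \<chi> v. (inv L \<circ> T \<circ> L) (y $ v - inv L a) + inv L a)"
    by (intro continuous_on_vec_lambda continuous_on_add continuous_on_const continuous_on_compose2[OF cont]
        continuous_on_diff linear_continuous_on bounded_linear_vec_nth) auto
  ultimately show ?thesis by simp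
qed

section \<open>Finiteness, connectedness and compactness from the fibres\<close>

lemma globally_rigid_orbit:
  assumes "globally_rigid E (place y0)" "pinned E y = pinned E y0"
  obtains T where "T \<in> linear_isometries" "y = act T (L (y0 $ v0)) y0"
proof -
  have "equivalent_frameworks E (place y0) (place y)"
    using assms(2) by (simp add: equivalent_frameworks_def pinned_def)
  then obtain g where g: "isometry g" "\<And>v. L (y $ v) = g (L (y0 $ v))"
    using assms(1) unfolding globally_rigid_def congruent_frameworks_def by (metis place_nth)
  obtain T where T: "T \<in> linear_isometries" "\<And>x. g x = T (x - L (y0 $ v0)) + g (L (y0 $ v0))"
    using isometry_affine[OF g(1)] by blast
  \<comment> \<open>Pinning \<open>v0\<close> removes the translation, leaving only the linear part
    of \<open>g\<close>.\<close>
  have "g (L (y0 $ v0)) = L (y0 $ v0)" using g(2)[of v0] assms(2) by (simp add: pinned_def)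
  then have "L (y $ v) = L (act T (L (y0 $ v0)) y0 $ v)" for v
    using g(2)[of v] T(2)[of "L (y0 $ v)"] by (simp add: L_act)
  then have "y = act T (L (y0 $ v0)) y0" by (simp add: vec_eq_iff L_eq_iff)
  then show ?thesis using that T(1) by blast
qed

lemma globally_rigid_finite_fibre:
  assumes "globally_rigid E (place y0)" "finite (linear_isometries :: ('a \<Rightarrow> 'a) set)"
  shows "finite {y. pinned E y = pinned E y0}"
proof (rule finite_subset)
  show "{y. pinned E y = pinned E y0} \<subseteq> (\<lambda>T. act T (L (y0 $ v0)) y0) ` linear_isometries"
    using globally_rigid_orbit[OF assms(1)] by blast
qed (use assms(2) in simp)

text \<open>If removing \<open>e\<close> disconnects the graph, one side can be translated in infinitely many ways
  that keep the length of \<open>e\<close>.\<close>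

lemma no_cut:
  fixes x y :: 'a
  assumes E: "simple_graph E" "e \<in> E" and fin: "finite {z. pinned E z = pinned E y0}"
    and wp: "well_positioned E (place y0)" and xy: "x \<noteq> 0" "\<And>t. y \<noteq> t *\<^sub>R x"
    and C: "v0 \<in> C" "\<And>v w. {v, w} \<in> E - {e} \<Longrightarrow> v \<in> C \<Longrightarrow> w \<in> C"
  shows "C = UNIV"
proof (rule ccontr)
  assume "C \<noteq> UNIV"
  then obtain c where c: "c \<notin> C" by blast
  \<comment> \<open>The ends are named so that, if \<open>C\<close> separates them, \<open>a\<close>
    is the one inside.\<close>
  obtain a b where ab: "e = {a, b}" "b \<in> C \<Longrightarrow> a \<in> C"
  proof -
    obtain a b where "e = {a, b}" using E by (metis card_2_iff simple_graph_def)
    then show thesis using that[of a b] that[of b a] by (metis insert_commute)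
  qed
  define p where "p = place y0"
  define d where "d = p $ b - p $ a"
  have "smooth_point (p $ a - p $ b)" using wp ab E(2) by (auto simp: well_positioned_def p_def)
  then have "d \<noteq> 0" by (auto simp: smooth_point_def d_def)
  \<comment> \<open>Everything outside \<open>C\<close> is translated so that, if \<open>C\<close>
    separates the ends of \<open>e\<close>, the vector from \<open>a\<close> to \<open>b\<close>
    becomes \<open>z\<close> instead of \<open>d\<close>.\<close>
  define Q where "Q z = (\<chi> v. if v \<in> C then p $ v else p $ v + (z - d))" for z
  have Q: "measurement E (Q z) = measurement E p" if z: "norm z = norm d" for z
    unfolding measurement_eq_iff[OF E(1)]
  proof (intro allI impI)
    fix v w assume vw: "{v, w} \<in> E"
    show "norm (Q z $ v - Q z $ w) = norm (p $ v - p $ w)"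
    proof (cases "v \<in> C \<longleftrightarrow> w \<in> C")
      case True
      then show ?thesis by (auto simp: Q_def)
    next
      case False
      then have "{v, w} = e" using C(2)[of v w] C(2)[of w v] vw by (auto simp: insert_commute)
      then have "v = a \<and> w = b \<or> v = b \<and> w = a" using ab(1) by (auto simp: doubleton_eq_iff)
      moreover from this have "a \<in> C" "b \<notin> C" using False ab(2) by auto
      ultimately show ?thesis using z by (auto simp: Q_def d_def norm_minus_commute)
    qed
  qed
  define pl where "pl q = (SOME z. place z = q)" for q
  have pl: "place (pl q) = q" for q unfolding pl_def by (rule someI_ex[OF place_surj])
  have "inj (\<lambda>z. pl (Q z))"
  proof (rule injI)
    fix z z' assume "pl (Q z) = pl (Q z')"
    then have "Q z $ c = Q z' $ c" using pl by metis
    then show "z = z'" using c by (simp add: Q_def)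
  qed
  then have "infinite ((\<lambda>z. pl (Q z)) ` {z. norm z = norm d})"
    using infinite_sphere[OF xy, of "norm d"] \<open>d \<noteq> 0\<close> by (simp add: finite_image_iff inj_on_subset)
  moreover have "(\<lambda>z. pl (Q z)) ` {z. norm z = norm d} \<subseteq> {z. pinned E z = pinned E y0}"
  proof clarify
    fix z :: 'a assume "norm z = norm d"
    have "place (pl (Q z)) $ v0 = place y0 $ v0" unfolding pl using C(1) by (simp add: Q_def p_def)
    then have "pl (Q z) $ v0 = y0 $ v0" by (simp add: place_nth L_eq_iff)
    then show "pinned E (pl (Q z)) = pinned E y0"
      using Q[OF \<open>norm z = norm d\<close>] by (simp add: pinned_def pl p_def)
  qed
  ultimately show False using fin finite_subset by blast
qed

text \<open>Bounds propagate along edges from the pinned vertex: the vertices with bounded positions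
  over the fibre form a set closed under adjacency, and \<open>cut\<close> expresses connectedness
  of \<open>H\<close>.\<close>

lemma compact_fibre:
  assumes H: "simple_graph H"
    and cut: "\<And>C. v0 \<in> C \<Longrightarrow> (\<And>v w. {v, w} \<in> H \<Longrightarrow> v \<in> C \<Longrightarrow> w \<in> C) \<Longrightarrow> C = UNIV"
  shows "compact {y. pinned H y = pinned H y0}" (is "compact ?S")
proof -
  have "closed ?S"
    by (intro closed_Collect_eq continuous_pinned continuous_on_const)
  moreover have "bounded ?S"
  proof -
    define C where "C = {v. \<exists>R. \<forall>y\<in>?S. norm (L (y $ v)) \<le> R}"
    have "C = UNIV"
    proof (rule cut)
      show "v0 \<in> C" by (auto simp: C_def pinned_def)
      fix v w assume vw: "{v, w} \<in> H" "v \<in> C"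
      then obtain R where R: "\<And>y. y \<in> ?S \<Longrightarrow> norm (L (y $ v)) \<le> R" unfolding C_def by blast
      have "norm (L (y $ w)) \<le> R + norm (place y0 $ v - place y0 $ w)" if y: "y \<in> ?S" for y
      proof -
        have "measurement H (place y) = measurement H (place y0)" using y by (simp add: pinned_def)
        then have "norm (place y $ v - place y $ w) = norm (place y0 $ v - place y0 $ w)"
          using vw(1) measurement_eq_iff[OF H] by blast
        then have "norm (L (y $ w)) \<le> norm (L (y $ v)) + norm (place y0 $ v - place y0 $ w)"
          using norm_triangle_sub[of "L (y $ w)" "L (y $ v)"] by (simp add: place_nth norm_minus_commute)
        then show ?thesis using R[OF y] by linarith
      qed
      then show "w \<in> C" unfolding C_def by blast
    qed
    then have "\<forall>v. \<exists>R. \<forall>y\<in>?S. norm (L (y $ v)) \<le> R" unfolding C_def by blast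
    then obtain R where R: "\<And>v y. y \<in> ?S \<Longrightarrow> norm (L (y $ v)) \<le> R v" by metis
    obtain B where B: "0 < B" "\<And>y. B * norm y \<le> norm (L y)"
      using linear_inj_bounded_below[OF L(1) bij_is_inj[OF L(2)]] by blast
    have "norm y \<le> (\<Sum>v\<in>UNIV. R v / B)" if "y \<in> ?S" for y
    proof -
      have "norm y \<le> (\<Sum>v\<in>UNIV. norm (y $ v))"
        unfolding norm_vec_def by (rule L2_set_le_sum) simp
      also have "\<dots> \<le> (\<Sum>v\<in>UNIV. R v / B)"
      proof (rule sum_mono)
        fix v
        have "norm (y $ v) * B \<le> R v" using B(2)[of "y $ v"] R[OF that, of v] by (simp add: mult.commute)
        then show "norm (y $ v) \<le> R v / B" using B(1) by (simp add: pos_le_divide_eq)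
      qed
      finally show ?thesis .
    qed
    then show ?thesis unfolding bounded_iff by blast
  qed
  ultimately show ?thesis by (simp add: compact_eq_bounded_closed)
qed

text \<open>Subtracting the motion of \<open>v0\<close> pins a flex. If nothing remained, the flex
  would be a translation, which is trivial with zero linear part.\<close>

lemma nontrivial_flex_pinned:
  assumes "well_positioned H (place y0)" "\<not> infinitesimally_rigid H (place y0)"
  obtains k where "blinfun_apply (pinned' H y0) k = 0" "k \<noteq> 0"
proof -
  obtain u where u: "rigidity_operator H (place y0) u = 0" "\<not> trivial_flex (place y0) u"
    using assms unfolding infinitesimally_rigid_def infinitesimal_flex_def by blast
  obtain x where x: "place x = u" using place_surj by blast
  define k where "k = (\<chi> v. x $ v - x $ v0)"
  have "edge_diff k e = edge_diff x e" for e by (simp add: k_def edge_diff_def)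
  then have "blinfun_apply (edge_len' e y0) k = blinfun_apply (edge_len' e y0) x" for e
    by (simp add: edge_len'_apply)
  then have "rigidity_operator H (place y0) (place k) = 0"
    using u(1) by (simp only: rigidity_operator_place x[symmetric])
  then have "blinfun_apply (pinned' H y0) k = 0" by (simp add: pinned'_apply k_def zero_prod_def)
  moreover have "k \<noteq> 0"
  proof
    assume "k = 0"
    then have "x $ v = x $ v0" for v by (simp add: k_def vec_eq_iff)
    then have "u $ v = (\<lambda>_. 0) (place y0 $ v) + L (x $ v0)" for v using x by (metis place_nth add_0)
    then have "trivial_flex (place y0) u"
      unfolding trivial_flex_def using linear_zero
      by (intro exI[of _ "\<lambda>_. 0"] exI[of _ "L (x $ v0)"]) auto
    then show False using u(2) by simp
  qed
  ultimately show ?thesis by (rule that)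
qed

text \<open>A placement fixed by a nontrivial isometry \<open>T\<close> allows each vertex to move along \<open>w - T w\<close>
  independently.\<close>

lemma fixed_placement_kernel:
  assumes T: "T \<in> linear_isometries" "T \<noteq> id" and z: "act T a z = z"
    and vs: "v1 \<noteq> v0" "v2 \<noteq> v0" "v1 \<noteq> v2"
  shows "2 \<le> dim {x. blinfun_apply (pinned' H z) x = 0}"
proof -
  obtain w where w: "T w \<noteq> w" using T(2) by (metis id_apply ext)
  \<comment> \<open>In coordinates, \<open>h\<close> is a direction killed by all support
    functionals of vectors fixed by \<open>T\<close>; \<open>axis v h\<close> moves only the vertex
    \<open>v\<close> along it.\<close>
  define h where "h = inv L (w - T w)"
  have "h \<noteq> 0" using w L_inv[of "w - T w"] linear_0[OF L(1)] by (auto simp: h_def)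
  have lin: "linear T" using T(1) by (simp add: linear_isometries_def)
  have fix_T: "T (L (edge_diff z e)) = L (edge_diff z e)" for e
  proof -
    have "T (L (z $ v) - a) = L (z $ v) - a" for v
      using L_act[of T a z v] z by (simp add: algebra_simps)
    then have "T ((L (z $ v) - a) - (L (z $ u) - a)) = (L (z $ v) - a) - (L (z $ u) - a)" for u v
      by (simp only: linear_diff[OF lin])
    then show ?thesis by (simp add: edge_diff_def linear_diff[OF L(1)])
  qed
  have ker: "blinfun_apply (pinned' H z) (axis v h) = 0" if "v \<noteq> v0" for v
  proof -
    have "blinfun_apply (edge_len' e z) (axis v h) = 0" for e
    proof -
      have "grad (edge_diff z e) \<bullet> h = 0"
        unfolding grad(2) h_def L_inv by (rule support_functional_fixed_by_isometry[OF smooth T(1) fix_T])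
      then have "grad (edge_diff z e) \<bullet> (axis v h $ u) = 0" for u by (simp add: axis_def)
      then show ?thesis by (simp add: edge_len'_apply edge_diff_def[of "axis v h"] inner_diff_right)
    qed
    then have "rigidity_operator H (place z) (place (axis v h)) = 0"
      by (simp add: rigidity_operator_place vec_eq_iff)
    then show ?thesis using that by (simp add: pinned'_apply zero_prod_def axis_def)
  qed
  have "axis v1 h \<bullet> axis v2 h = 0" using vs by (simp add: inner_axis) (simp add: axis_def)
  moreover have ne: "axis v h \<noteq> 0" for v using \<open>h \<noteq> 0\<close> by (metis axis_eq_0_iff)
  moreover have neq: "axis v1 h \<noteq> axis v2 h" using vs(3) \<open>h \<noteq> 0\<close> by (metis axis_eq_axis)
  ultimately have "independent {axis v1 h, axis v2 h}"
    by (intro pairwise_orthogonal_independent)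
      (auto simp: pairwise_def orthogonal_def inner_commute dest: sym[of 0])
  then have "card {axis v1 h, axis v2 h} \<le> dim {x. blinfun_apply (pinned' H z) x = 0}"
    using ker vs by (intro independent_card_le_dim) auto
  then show ?thesis using neq by simp
qed

lemma infinitesimally_rigid_remove_edge:
  fixes x y :: 'a
  assumes E: "simple_graph E" "e \<in> E" and V: "CARD('v) \<ge> 2"
    and csr: "completely_strongly_regular (place y0)"
    and gr: "globally_rigid E (place y0)"
    and fin: "finite (linear_isometries :: ('a \<Rightarrow> 'a) set)"
    and xy: "x \<noteq> 0" "\<And>t. y \<noteq> t *\<^sub>R x"
  shows "infinitesimally_rigid (E - {e}) (place y0)"
proof (rule ccontr)
  assume not_rigid: "\<not> infinitesimally_rigid (E - {e}) (place y0)"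
  define H where "H = E - {e}"
  have H: "simple_graph H" using E by (simp add: H_def simple_graph_def)
  have regE: "well_positioned E (place y0)" "strongly_regular E (place y0)"
    and regH: "well_positioned H (place y0)" "strongly_regular H (place y0)"
    using csr E(1) H unfolding completely_strongly_regular_def by blast+
  have fin_fibre: "finite {y. pinned E y = pinned E y0}"
    by (rule globally_rigid_finite_fibre[OF gr fin])
  have cut: "C = UNIV" if "v0 \<in> C" "\<And>v w. {v, w} \<in> H \<Longrightarrow> v \<in> C \<Longrightarrow> w \<in> C" for C
    using no_cut[OF E fin_fibre regE(1) xy] that unfolding H_def by blast
  let ?kerE = "\<lambda>y. {x. blinfun_apply (pinned' E y) x = 0}"
  let ?kerH = "\<lambda>y. {x. blinfun_apply (pinned' H y) x = 0}"
  \<comment> \<open>A nonzero pinned flex of \<open>E\<close> would, the rank being locally maximal,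
    produce infinitely many equivalent pinned placements.\<close>
  have kerE0: "x = 0" if x: "blinfun_apply (pinned' E y0) x = 0" for x
  proof (rule ccontr)
    assume "x \<noteq> 0"
    obtain U where U: "open U" "y0 \<in> U"
      "\<And>z. z \<in> U \<Longrightarrow> dim (range (blinfun_apply (pinned' E z))) \<le> dim (range (blinfun_apply (pinned' E y0)))"
      using regular_rank[OF regE(2) refl] by metis
    have "infinite {y. pinned E y = pinned E y0}"
      by (rule infinite_fibre[OF pinned_has_derivative continuous_pinned' U x \<open>x \<noteq> 0\<close>])
    then show False using fin_fibre by simp
  qed
  \<comment> \<open>Strong regularity carries the zero kernel along the fibre of \<open>E\<close>:
    there the derivative of \<open>edge_len e\<close> is injective on the kernel for
    \<open>H\<close>.\<close>
  have kerE: "x = 0"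
    if "pinned E y = pinned E y0" "blinfun_apply (pinned' H y) x = 0" "blinfun_apply (edge_len' e y) x = 0" for x y
  proof -
    have "measurement E (place y) = measurement E (place y0)" using that(1) by (simp add: pinned_def)
    then have "dim (?kerE y) = dim (?kerE y0)" using regular_rank[OF regE(2)] by metis
    also have "\<dots> = 0" using kerE0 by (auto simp: dim_eq_0)
    finally have "?kerE y \<subseteq> {0}" by simp
    then show ?thesis using that(2,3) pinned'_insert[OF E(2)] by (auto simp: H_def)
  qed
  have lin: "linear (blinfun_apply f)" for f :: "((real^'b)^'v) \<Rightarrow>\<^sub>L ('z::real_normed_vector)"
    by (simp add: blinfun.bounded_linear_right bounded_linear.linear)
  \<comment> \<open>One linear condition, the derivative of the length of \<open>e\<close>, cuts
    this kernel down to zero, so its dimension is at most one; the assumed nontrivial flex makes it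
    exactly one.\<close>
  have dim0: "dim (?kerH y0) = 1"
  proof -
    let ?f = "blinfun_apply (edge_len' e y0)"
    have sub: "subspace (?kerH y0)" by (rule linear_subspace_kernel[OF lin])
    have "{x \<in> ?kerH y0. ?f x = 0} \<subseteq> {0}" using kerE[of y0] by auto
    then have "dim {x \<in> ?kerH y0. ?f x = 0} = 0" by simp
    moreover have "dim (?f ` ?kerH y0) + dim {x \<in> ?kerH y0. ?f x = 0} = dim (?kerH y0)"
      by (rule dim_image_plus_kernel[OF lin sub])
    moreover have "dim (?f ` ?kerH y0) \<le> 1" using dim_subset_UNIV[of "?f ` ?kerH y0"] by simp
    moreover obtain k where "blinfun_apply (pinned' H y0) k = 0" "k \<noteq> 0"
      using nontrivial_flex_pinned[OF regH(1)] not_rigid unfolding H_def by blast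
    then have "\<not> ?kerH y0 \<subseteq> {0}" by blast
    then have "dim (?kerH y0) \<noteq> 0" by (simp only: dim_eq_0 not_False_eq_True)
    ultimately show ?thesis by linarith
  qed
  define S where "S = {y. pinned H y = pinned H y0}"
  have rankS: "\<exists>U. open U \<and> y \<in> U \<and>
      (\<forall>z\<in>U. dim (range (blinfun_apply (pinned' H z))) \<le> dim (range (blinfun_apply (pinned' H y)))) \<and>
      dim (?kerH y) = 1" if "y \<in> S" for y
  proof -
    have "measurement H (place y) = measurement H (place y0)" using that by (simp add: S_def pinned_def)
    then show ?thesis using regular_rank[OF regH(2), of y] dim0 by metis
  qed
  have chart: "\<exists>N \<delta> \<gamma>. open N \<and> y \<in> N \<and> 0 < \<delta> \<and> homeomorphism (S \<inter> N) {f y - \<delta><..<f y + \<delta>} f \<gamma>"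
    if y: "y \<in> S" and f: "\<And>x. (f has_derivative blinfun_apply (f' x)) (at x)" "continuous_on UNIV f'"
      and inj: "\<And>v. blinfun_apply (pinned' H y) v = 0 \<Longrightarrow> blinfun_apply (f' y) v = 0 \<Longrightarrow> v = 0"
    for y f and f' :: "(real^'b)^'v \<Rightarrow> (((real^'b)^'v) \<Rightarrow>\<^sub>L real)"
  proof -
    obtain U where U: "open U" "y \<in> U"
      "\<And>z. z \<in> U \<Longrightarrow> dim (range (blinfun_apply (pinned' H z))) \<le> dim (range (blinfun_apply (pinned' H y)))"
      "dim (?kerH y) = 1" using rankS[OF y] by blast
    obtain N \<delta> \<gamma> where N: "open N" "y \<in> N" "0 < \<delta>"
      "homeomorphism {x \<in> N. pinned H x = pinned H y} {f y - \<delta><..<f y + \<delta>} f \<gamma>"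
      by (rule one_dimensional_fibre[OF pinned_has_derivative continuous_pinned' f U inj])
    moreover have "{x \<in> N. pinned H x = pinned H y} = S \<inter> N" using y by (auto simp: S_def)
    ultimately show ?thesis by auto
  qed
  define c where "c = edge_len e y0"
  define M where "M = {y \<in> S. c \<le> edge_len e y}"
  have "compact S" unfolding S_def by (rule compact_fibre[OF H cut])
  moreover have "closed {y. c \<le> edge_len e y}"
    by (intro closed_Collect_le continuous_edge_len continuous_on_const)
  moreover have "M = S \<inter> {y. c \<le> edge_len e y}" by (auto simp: M_def)
  ultimately have compM: "compact M" by (simp add: compact_Int_closed)
  \<comment> \<open>The length of \<open>e\<close> may be critical here, so the coordinate is the
    inner product with a kernel vector \<open>k\<close>.\<close>
  have M_open: "open_chart_at M y" if y: "y \<in> M" and gt: "c < edge_len e y" for y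
  proof -
    have yS: "y \<in> S" using y by (simp add: M_def)
    have sub: "subspace (?kerH y)" by (rule linear_subspace_kernel[OF lin])
    have dim1: "dim (?kerH y) = 1" using rankS[OF yS] by blast
    then have "\<not> ?kerH y \<subseteq> {0}" by (metis dim_eq_0 zero_neq_one)
    then obtain k where k: "k \<in> ?kerH y" "k \<noteq> 0" by blast
    have "\<exists>N \<delta> \<gamma>. open N \<and> y \<in> N \<and> 0 < \<delta> \<and>
        homeomorphism (S \<inter> N) {k \<bullet> y - \<delta><..<k \<bullet> y + \<delta>} (\<lambda>x. k \<bullet> x) \<gamma>"
    proof (rule chart[OF yS, of _ "\<lambda>_. blinfun_inner_right k"])
      show "((\<lambda>x. k \<bullet> x) has_derivative blinfun_apply (blinfun_inner_right k)) (at x)" for x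
        using bounded_linear_imp_has_derivative[OF bounded_linear_inner_right] by (simp add: fun_eq_iff)
      fix v assume v: "blinfun_apply (pinned' H y) v = 0" "blinfun_apply (blinfun_inner_right k) v = 0"
      have "span {k} = ?kerH y"
      proof (rule subspace_dim_equal)
        show "span {k} \<subseteq> ?kerH y" by (intro span_minimal sub) (use k in simp)
        show "dim (?kerH y) \<le> dim (span {k})" unfolding dim1 using k(2) by (simp add: dim_insert)
      qed (use sub in auto)
      then obtain t where "v = t *\<^sub>R k" using v(1) by (auto simp: span_singleton)
      then show "v = 0" using v(2) k(2) by simp
    qed (rule continuous_on_const)
    then have "open_chart_at S y" unfolding open_chart_at_def by blast
    moreover have "open {x. c < edge_len e x}"
      by (intro open_Collect_less continuous_edge_len continuous_on_const)
    moreover have "S \<inter> {x. c < edge_len e x} = M \<inter> {x. c < edge_len e x}" by (auto simp: M_def)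
    ultimately show ?thesis using open_chart_at_local[of S y "{x. c < edge_len e x}" M] yS gt by simp
  qed
  have M_level: "pinned E y = pinned E y0" if "y \<in> M" "edge_len e y = c" for y
    using that pinned_insert[OF E(2)] by (simp add: M_def S_def c_def H_def)
  \<comment> \<open>On level \<open>c\<close> the length itself is a coordinate of \<open>S\<close>,
    and passing to \<open>M\<close> cuts its interval at the left end \<open>c\<close>.\<close>
  have M_end: "end_chart_at M y" if y: "y \<in> M" and eq: "edge_len e y = c" for y
  proof -
    have yS: "y \<in> S" using y by (simp add: M_def)
    have "\<exists>N \<delta> \<gamma>. open N \<and> y \<in> N \<and> 0 < \<delta> \<and>
        homeomorphism (S \<inter> N) {edge_len e y - \<delta><..<edge_len e y + \<delta>} (edge_len e) \<gamma>"
      by (rule chart[OF yS edge_len_has_derivative continuous_edge_len' kerE[OF M_level[OF y eq]]])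
    then obtain N \<delta> \<gamma> where N: "open N" "y \<in> N" "0 < \<delta>"
      and hom: "homeomorphism (S \<inter> N) {c - \<delta><..<c + \<delta>} (edge_len e) \<gamma>"
      unfolding eq by blast
    have "edge_len e ` (M \<inter> N) = {c..<c + \<delta>}"
    proof
      show "edge_len e ` (M \<inter> N) \<subseteq> {c..<c + \<delta>}"
        using homeomorphism_image1[OF hom] by (force simp: M_def)
      show "{c..<c + \<delta>} \<subseteq> edge_len e ` (M \<inter> N)"
      proof
        fix t assume t: "t \<in> {c..<c + \<delta>}"
        then have "t \<in> edge_len e ` (S \<inter> N)" using homeomorphism_image1[OF hom] N(3) by auto
        then show "t \<in> edge_len e ` (M \<inter> N)" using t by (auto simp: M_def)
      qed
    qed
    then have "homeomorphism (M \<inter> N) {c..<c + \<delta>} (edge_len e) \<gamma>"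
      using N(3) by (intro homeomorphism_of_subsets[OF hom]) (auto simp: M_def)
    then show ?thesis unfolding end_chart_at_def using N eq by blast
  qed
  define B where "B = connected_component_set M y0"
  have y0M: "y0 \<in> M" by (simp add: M_def S_def c_def)
  have y0B: "y0 \<in> B" using y0M by (simp add: B_def)
  have BM: "B \<subseteq> M" unfolding B_def by (rule connected_component_subset)
  have connB: "connected B" by (simp add: B_def connected_connected_component)
  have compB: "compact B" unfolding B_def
    using compact_components[OF compM] componentsI[OF y0M] by blast
  have B_open: "open_chart_at B y" if "y \<in> B" "edge_len e y \<noteq> c" for y
  proof -
    have "y \<in> M" using that BM by blast
    moreover from this have "c < edge_len e y" using that(2) by (simp add: M_def)
    ultimately show ?thesis
      using open_chart_at_component[OF M_open] that(1) unfolding B_def by blast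
  qed
  have B_end: "end_chart_at B y" if "y \<in> B" "edge_len e y = c" for y
    using end_chart_at_component[OF M_end] that BM unfolding B_def by blast
  \<comment> \<open>Otherwise \<open>y0\<close> would be the single end of a compact connected
    1-manifold.\<close>
  obtain q where q: "q \<in> B" "q \<noteq> y0" "edge_len e q = c"
    using not_single_end_chart[OF compB connB y0B B_end[OF y0B c_def[symmetric]]] B_open by blast
  define a where "a = L (y0 $ v0)"
  obtain T where T: "T \<in> linear_isometries" "q = act T a y0"
    using globally_rigid_orbit[OF gr M_level] q BM unfolding a_def by blast
  have "T \<noteq> id"
  proof
    assume "T = id"
    then have "act T a y0 = y0" by (simp add: act_def vec_eq_iff inv_L)
    then show False using q(2) T(2) by simp
  qed
  have act_M: "act T a z \<in> M" if "z \<in> M" for z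
  proof -
    have "z $ v0 = y0 $ v0" using that by (simp add: M_def S_def pinned_def)
    then have "pinned H (act T a z) = pinned H z" by (intro pinned_act T(1)) (simp add: a_def)
    then show ?thesis using that edge_len_act[OF T(1)] by (simp add: M_def S_def)
  qed
  have cont: "continuous_on B (act T a)" by (rule continuous_on_subset[OF continuous_act[OF T(1)]]) simp
  \<comment> \<open>The image of \<open>B\<close> is connected, stays in \<open>M\<close> and
    contains \<open>q\<close>, the image of \<open>y0\<close>; as \<open>q\<close> lies in
    \<open>B\<close>, so does the whole image.\<close>
  have "act T a ` B \<subseteq> connected_component_set M q"
    using T(2) y0B BM act_M by (intro connected_component_maximal connected_continuous_image cont connB) auto
  also have "connected_component_set M q = B"
    using q(1) unfolding B_def by (metis connected_component_eq)
  finally have "act T a ` B \<subseteq> B" .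
  moreover have "\<And>y. y \<in> B \<Longrightarrow> open_chart_at B y \<or> end_chart_at B y" using B_open B_end by blast
  ultimately obtain z where z: "z \<in> B" "act T a z = z"
    using fixpoint_if_two_end_charts[OF connB _ y0B B_end[OF y0B c_def[symmetric]] q(1) B_end[OF q(1,3)] q(2)[symmetric] cont]
    by metis
  \<comment> \<open>\<open>H\<close> is connected on at least two vertices, so it has an edge;
    together with \<open>e\<close> this edge covers at least three vertices, two of them different
    from \<open>v0\<close>.\<close>
  obtain v1 v2 where v: "v1 \<noteq> v0" "v2 \<noteq> v0" "v1 \<noteq> v2"
  proof -
    have "H \<noteq> {}"
    proof
      assume "H = {}"
      then have "{v0} = UNIV" using cut[of "{v0}"] by simp
      then have "CARD('v) = 1" by (metis card_1_singleton_iff One_nat_def)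
      then show False using V by simp
    qed
    then obtain e' where e': "e' \<in> E" "e' \<noteq> e" by (auto simp: H_def)
    have "card e = 2" "card e' = 2" using E e' by (auto simp: simple_graph_def)
    then have "\<not> e' \<subseteq> e" using e'(2) card_subset_eq[of e e'] by auto
    then have "card e < card (e \<union> e')" by (intro psubset_card_mono) auto
    also have "\<dots> \<le> CARD('v)" by (intro card_mono) auto
    finally have "2 \<le> card (UNIV - {v0})" using \<open>card e = 2\<close> by (simp add: card_Diff_singleton)
    then obtain W where "W \<subseteq> UNIV - {v0}" "card W = 2" by (meson obtain_subset_with_card_n)
    then obtain v1 v2 where "W = {v1, v2}" "v1 \<noteq> v2" by (auto simp: card_2_iff)
    then show ?thesis using that[of v1 v2] \<open>W \<subseteq> UNIV - {v0}\<close> by auto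
  qed
  have "2 \<le> dim (?kerH z)" by (rule fixed_placement_kernel[OF T(1) \<open>T \<noteq> id\<close> z(2) v])
  moreover have "dim (?kerH z) = 1" using rankS[of z] z(1) BM by (auto simp: M_def)
  ultimately show False by simp
qed

end

theorem theorem3p7:
  fixes E :: "'v::finite set set" and p :: "('a::real_normed_vector)^'v" and d :: nat
  assumes "has_dimension TYPE('a) d"
    and "smooth_space TYPE('a)"
    and "non_Euclidean TYPE('a)"
    and "finite (linear_isometries :: ('a \<Rightarrow> 'a) set)"
    and "simple_graph E"
    and "CARD('v) \<ge> 2"
    and "completely_strongly_regular p"
    and "globally_rigid E p"
  shows "redundantly_rigid E p"
proof -
  obtain x y :: 'a where xy: "x \<noteq> 0" "\<And>t. y \<noteq> t *\<^sub>R x"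
    using non_Euclidean_independent_vectors[OF assms(3)] by blast
  obtain L :: "real^('a basis_index) \<Rightarrow> 'a" where L: "linear L" "bij L"
    using basis_coordinates_exist[OF assms(1) xy(1)] by blast
  \<comment> \<open>\<open>undefined\<close> stands for an arbitrary vertex; any of them can be
    pinned.\<close>
  interpret coordinates L "undefined :: 'v"
    by (rule coordinates.intro[OF assms(2) L])
  obtain y0 where "place y0 = p" using place_surj by blast
  then show ?thesis
    unfolding redundantly_rigid_def
    using infinitesimally_rigid_remove_edge[OF assms(5) _ assms(6) _ _ assms(4) xy] assms(7,8) by blast
qed

end
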